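(* Let $d\ge3$ be a constant and let $\mathbf G$ be a uniformly random $d$-regular graph on $n$ vertices. There is a universal constant $\eta_0>0$ such that for any $\eta\in(0,\eta_0)$ there is an algorithm which, given $\mathbf G$, outputs a number $N(\mathbf G)$ such that for every input $d$-regular graph $G$ the number of independent sets of $G$ of size $C_d(1-\eta)n$ is at most $N(G)$, and with high probability over $\mathbf G$, $N(\mathbf G)\le 2^{O(\eta^{3/5}\log\frac1\eta)n}$.
   Context: $r_d:=\frac{2\sqrt{d-1}}{d}$ and $C_d:=\frac{r_d}{1+r_d}$. "With high probability" means with probability $1-o(1)$ as $n\to\infty$. *)

theory Defs
  imports "HOL-Probability.Probability" "HOL-Library.Nat_Bijection"
begin

definition r_d :: "nat \<Rightarrow> real" where
  "r_d d = 2 * sqrt (real d - 1) / real d"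

definition C_d :: "nat \<Rightarrow> real" where
  "C_d d = r_d d / (1 + r_d d)"

text \<open>A labelled simple graph on the vertex set \<open>{..<n}\<close> is given by its set of edges, each a
  two-element set of vertices.\<close>

definition simple_graph :: "nat \<Rightarrow> nat set set \<Rightarrow> bool" where
  "simple_graph n E \<longleftrightarrow> (\<forall>e\<in>E. e \<subseteq> {..<n} \<and> card e = 2)"

definition vdegree :: "nat set set \<Rightarrow> nat \<Rightarrow> nat" where
  "vdegree E v = card {e \<in> E. v \<in> e}"

definition regular_graphs :: "nat \<Rightarrow> nat \<Rightarrow> nat set set set" where
  "regular_graphs n d = {E. simple_graph n E \<and> (\<forall>v<n. vdegree E v = d)}"

definition independent_set :: "nat \<Rightarrow> nat set set \<Rightarrow> nat set \<Rightarrow> bool" where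
  "independent_set n E S \<longleftrightarrow> S \<subseteq> {..<n} \<and> (\<forall>u\<in>S. \<forall>v\<in>S. {u, v} \<notin> E)"

definition num_independent_sets :: "nat \<Rightarrow> nat set set \<Rightarrow> nat \<Rightarrow> nat" where
  "num_independent_sets n E k = card {S. independent_set n E S \<and> card S = k}"

text \<open>The general recursive functions: \<open>recursive k f\<close> says that \<open>f\<close>, restricted to argument
  lists of length \<open>k\<close>, is a total recursive function of \<open>k\<close> variables. Minimisation is applied to
  regular functions only, so no partial functions are needed; values of \<open>f\<close> on lists of another
  length are never used.\<close>

inductive recursive :: "nat \<Rightarrow> (nat list \<Rightarrow> nat) \<Rightarrow> bool" where
  zero: "recursive k (\<lambda>xs. 0)"
| succ: "recursive 1 (\<lambda>xs. Suc (hd xs))"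
| proj: "i < k \<Longrightarrow> recursive k (\<lambda>xs. xs ! i)"
| comp: "recursive (length gs) f \<Longrightarrow> (\<forall>g\<in>set gs. recursive k g) \<Longrightarrow>
    recursive k (\<lambda>xs. f (map (\<lambda>g. g xs) gs))"
| prec: "recursive k f \<Longrightarrow> recursive (k + 2) g \<Longrightarrow>
    recursive (k + 1) (\<lambda>xs. rec_nat (f (tl xs)) (\<lambda>y r. g (y # r # tl xs)) (hd xs))"
| minim: "recursive (k + 1) f \<Longrightarrow> (\<forall>xs. length xs = k \<longrightarrow> (\<exists>y. f (y # xs) = 0)) \<Longrightarrow>
    recursive k (\<lambda>xs. LEAST y. f (y # xs) = 0)"

definition computable :: "(nat \<Rightarrow> nat) \<Rightarrow> bool" where
  "computable A \<longleftrightarrow> (\<exists>f. recursive 1 f \<and> (\<forall>x. A x = f [x]))"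

text \<open>The input given to an algorithm: the number of vertices together with the adjacency
  relation, whose characteristic bits form the binary expansion of \<open>set_encode\<close>.\<close>

definition graph_code :: "nat \<Rightarrow> nat set set \<Rightarrow> nat" where
  "graph_code n E = prod_encode (n, set_encode {prod_encode (u, v) | u v. {u, v} \<in> E})"

text \<open>The limit is along those \<open>n\<close> for which \<open>d * n\<close> is even; for all but finitely many of
  these, \<open>regular_graphs n d\<close> is nonempty, so that \<open>pmf_of_set\<close> is its uniform distribution
  (for odd \<open>d * n\<close> there are no \<open>d\<close>-regular graphs on \<open>n\<close> vertices).\<close>

definition whp_regular :: "nat \<Rightarrow> (nat \<Rightarrow> nat set set \<Rightarrow> bool) \<Rightarrow> bool" where
  "whp_regular d P \<longleftrightarrow>
    ((\<lambda>n. measure_pmf.prob (pmf_of_set (regular_graphs n d)) {G. P n G}) \<longlongrightarrow> 1)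
      (inf sequentially (principal {n. even (d * n)}))"

end

theory Submission
  imports Defs "HOL-Real_Asymp.Real_Asymp"
begin

text \<open>
  Independent sets of density close to \<open>C_d d\<close> are so large that with high probability a random
  \<open>d\<close>-regular graph has none at all, so exhaustive counting is an algorithm with the required
  properties: the count is almost always \<open>0\<close>.

  This follows from a first-moment bound. For a set \<open>S\<close> of \<open>k = \<alpha> n\<close> vertices, let \<open>a i\<close> be the
  number of \<open>d\<close>-regular graphs with \<open>i\<close> ordered pairs of adjacent vertices in \<open>S\<close>. Exchanging two
  edges that leave \<open>S\<close> for one inside \<open>S\<close> and one outside raises \<open>i\<close> by \<open>2\<close>, and double counting
  these switchings bounds \<open>a i / a (i + 2)\<close>. Multiplying the bounds up to the typical value
  \<open>i = 2 J\<close>, \<open>J = d \<alpha>\<^sup>2 n / 2\<close>, shows that \<open>S\<close> is independent with probability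
  at most \<open>exp (- 0.705 n)\<close> up to smaller factors, and there are only \<open>2 ^ n\<close> sets \<open>S\<close>,
  where \<open>ln 2 < 0.695\<close>.
\<close>

section \<open>Computability of the exhaustive count\<close>

text \<open>The constructors of \<open>recursive\<close> fix a function on lists of every length.
  Only lists of length \<open>k\<close> carry meaning, so agreement there is all that is asked, and
  the class becomes closed under pointwise reformulation.\<close>

definition recursive_on :: "nat \<Rightarrow> (nat list \<Rightarrow> nat) \<Rightarrow> bool" where
  "recursive_on k f \<longleftrightarrow> (\<exists>g. recursive k g \<and> (\<forall>xs. length xs = k \<longrightarrow> f xs = g xs))"

lemma recursive_on_cong:
  assumes "recursive_on k f" "\<And>xs. length xs = k \<Longrightarrow> f xs = g xs"
  shows "recursive_on k g"
  using assms unfolding recursive_on_def by metis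

lemma recursive_on_recursive: "recursive k f \<Longrightarrow> recursive_on k f"
  unfolding recursive_on_def by blast

lemma recursive_on_nth: "i < k \<Longrightarrow> recursive_on k (\<lambda>xs. xs ! i)"
  by (intro recursive_on_recursive recursive.proj)

text \<open>Substitution with the arguments given by one list-valued \<open>h\<close>, so that
  rearrangements such as \<open>b xs # xs\<close> or the removal of an entry are instances.\<close>

lemma recursive_on_comp:
  assumes f: "recursive_on m f"
    and h: "\<And>i. i < m \<Longrightarrow> recursive_on k (\<lambda>xs. h xs ! i)"
    and len: "\<And>xs. length xs = k \<Longrightarrow> length (h xs) = m"
  shows "recursive_on k (\<lambda>xs. f (h xs))"
proof -
  obtain f' where f': "recursive m f'" "\<And>xs. length xs = m \<Longrightarrow> f xs = f' xs"
    using f unfolding recursive_on_def by blast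
  have "\<forall>i. \<exists>g. i < m \<longrightarrow> recursive k g \<and> (\<forall>xs. length xs = k \<longrightarrow> h xs ! i = g xs)"
    using h unfolding recursive_on_def by blast
  then obtain G where G: "\<And>i. i < m \<Longrightarrow> recursive k (G i)"
    "\<And>i xs. i < m \<Longrightarrow> length xs = k \<Longrightarrow> h xs ! i = G i xs"
    by metis
  let ?gs = "map G [0..<m]"
  have "recursive k (\<lambda>xs. f' (map (\<lambda>g. g xs) ?gs))"
    by (rule recursive.comp) (use f' G in auto)
  moreover have "f (h xs) = f' (map (\<lambda>g. g xs) ?gs)" if "length xs = k" for xs
  proof -
    have "h xs = map (\<lambda>g. g xs) ?gs"
      using that G len by (intro nth_equalityI) auto
    then show ?thesis using f' len that by metis
  qed
  ultimately show ?thesis unfolding recursive_on_def by blast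
qed

lemma recursive_on_prec:
  assumes "recursive_on k f" "recursive_on (k + 2) g"
  shows "recursive_on (k + 1) (\<lambda>xs. rec_nat (f (tl xs)) (\<lambda>y r. g (y # r # tl xs)) (hd xs))"
proof -
  obtain f' where f': "recursive k f'" "\<And>xs. length xs = k \<Longrightarrow> f xs = f' xs"
    using assms unfolding recursive_on_def by blast
  obtain g' where g': "recursive (k + 2) g'" "\<And>xs. length xs = k + 2 \<Longrightarrow> g xs = g' xs"
    using assms unfolding recursive_on_def by blast
  have "rec_nat (f (tl xs)) (\<lambda>y r. g (y # r # tl xs)) m =
        rec_nat (f' (tl xs)) (\<lambda>y r. g' (y # r # tl xs)) m" if "length xs = k + 1" for xs m
    by (induction m) (use that f' g' in auto)
  then show ?thesis
    using recursive.prec[OF f'(1) g'(1)] unfolding recursive_on_def by blast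
qed

lemma recursive_on_unary:
  assumes "recursive_on 1 (\<lambda>xs. F (xs ! 0))" "recursive_on k a"
  shows "recursive_on k (\<lambda>xs. F (a xs))"
  using recursive_on_comp[OF assms(1), of k "\<lambda>xs. [a xs]"] assms(2) by simp

lemma recursive_on_binary:
  assumes "recursive_on 2 (\<lambda>xs. F (xs ! 0) (xs ! 1))" "recursive_on k a" "recursive_on k b"
  shows "recursive_on k (\<lambda>xs. F (a xs) (b xs))"
proof -
  have "recursive_on k (\<lambda>xs. [a xs, b xs] ! i)" if "i < 2" for i
    using that assms(2,3) by (auto simp: less_2_cases_iff)
  from recursive_on_comp[OF assms(1) this] show ?thesis by simp
qed

lemma recursive_on_Suc:
  assumes "recursive_on k a"
  shows "recursive_on k (\<lambda>xs. Suc (a xs))"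
proof (rule recursive_on_unary[OF _ assms])
  show "recursive_on 1 (\<lambda>xs. Suc (xs ! 0))"
    by (rule recursive_on_cong[OF recursive_on_recursive[OF recursive.succ]])
       (auto simp: length_Suc_conv)
qed

lemma recursive_on_const: "recursive_on k (\<lambda>xs. c)"
  by (induction c) (auto intro: recursive_on_Suc recursive_on_recursive recursive.zero)

lemma recursive_on_rec_nat:
  assumes "recursive_on k f" "recursive_on (k + 2) g" "recursive_on k b"
  shows "recursive_on k (\<lambda>xs. rec_nat (f xs) (\<lambda>y r. g (y # r # xs)) (b xs))"
proof -
  have "recursive_on k (\<lambda>xs. (b xs # xs) ! i)" if "i < k + 1" for i
    using that assms(3) by (cases i) (auto intro: recursive_on_nth)
  from recursive_on_comp[OF recursive_on_prec[OF assms(1,2)] this]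
  show ?thesis by simp
qed

section \<open>Arithmetic, bounded sums and bounded products\<close>

lemma recursive_on_add:
  assumes "recursive_on k a" "recursive_on k b"
  shows "recursive_on k (\<lambda>xs. a xs + b xs)"
proof -
  have "recursive_on k (\<lambda>xs. rec_nat (a xs) (\<lambda>y r. (\<lambda>zs. Suc (zs ! 1)) (y # r # xs)) (b xs))"
    by (intro recursive_on_rec_nat assms recursive_on_Suc recursive_on_nth) auto
  moreover have "rec_nat m (\<lambda>y r. Suc r) n = m + n" for m n by (induction n) auto
  ultimately show ?thesis by simp
qed

lemma recursive_on_mult:
  assumes "recursive_on k a" "recursive_on k b"
  shows "recursive_on k (\<lambda>xs. a xs * b xs)"
proof (rule recursive_on_binary[OF _ assms])
  have "recursive_on 2 (\<lambda>xs. rec_nat 0 (\<lambda>y r. (\<lambda>zs. zs ! 1 + zs ! 2) (y # r # xs)) (xs ! 1))"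
    by (intro recursive_on_rec_nat recursive_on_add recursive_on_nth recursive_on_const) auto
  moreover have "rec_nat 0 (\<lambda>y r. r + m) n = m * n" for m n by (induction n) auto
  ultimately show "recursive_on 2 (\<lambda>xs. xs ! 0 * xs ! 1)" by simp
qed

lemma recursive_on_diff:
  assumes "recursive_on k a" "recursive_on k b"
  shows "recursive_on k (\<lambda>xs. a xs - b xs)"
proof (rule recursive_on_binary[OF _ assms])
  have pred: "recursive_on 1 (\<lambda>xs. xs ! 0 - 1)"
  proof -
    have "recursive_on 1 (\<lambda>xs. rec_nat 0 (\<lambda>y r. (\<lambda>zs. zs ! 0) (y # r # xs)) (xs ! 0))"
      by (intro recursive_on_rec_nat recursive_on_nth recursive_on_const) auto
    moreover have "rec_nat 0 (\<lambda>y r. y) n = n - 1" for n :: nat by (cases n) auto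
    ultimately show ?thesis by simp
  qed
  have "recursive_on 2 (\<lambda>xs. rec_nat (xs ! 0) (\<lambda>y r. (\<lambda>zs. zs ! 1 - 1) (y # r # xs)) (xs ! 1))"
    by (intro recursive_on_rec_nat recursive_on_nth recursive_on_unary[OF pred]) auto
  moreover have "rec_nat m (\<lambda>y r. r - 1) n = m - n" for m n :: nat by (induction n) auto
  ultimately show "recursive_on 2 (\<lambda>xs. xs ! 0 - xs ! 1)" by simp
qed

text \<open>The step function of a primitive recursion receives counter, accumulator and parameters.
  A summand or factor depends on counter and parameters only, so the accumulator at position 1 has
  to be bypassed.\<close>

lemma recursive_on_skip:
  assumes "recursive_on (Suc k) f"
  shows "recursive_on (k + 2) (\<lambda>zs. f (zs ! 0 # drop 2 zs))"
proof (rule recursive_on_comp[OF assms])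
  fix i assume "i < Suc k"
  have "recursive_on (k + 2) (\<lambda>zs. zs ! (if i = 0 then 0 else Suc i))"
    using \<open>i < Suc k\<close> by (intro recursive_on_nth) auto
  then show "recursive_on (k + 2) (\<lambda>zs. (zs ! 0 # drop 2 zs) ! i)"
    by (rule recursive_on_cong) (use \<open>i < Suc k\<close> in \<open>cases i; auto\<close>)
qed auto

lemma recursive_on_sum:
  assumes "recursive_on k b" "recursive_on (Suc k) (\<lambda>ys. f (ys ! 0) (tl ys))"
  shows "recursive_on k (\<lambda>xs. \<Sum>i<b xs. f i xs)"
proof -
  have "recursive_on k (\<lambda>xs. rec_nat 0 (\<lambda>y r. (\<lambda>zs. zs ! 1 + f (zs ! 0) (drop 2 zs)) (y # r # xs)) (b xs))"
    using recursive_on_skip[OF assms(2)]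
    by (intro recursive_on_rec_nat recursive_on_add recursive_on_nth recursive_on_const assms) auto
  moreover have "rec_nat 0 (\<lambda>y r. r + f y xs) n = (\<Sum>i<n. f i xs)" for n xs by (induction n) auto
  ultimately show ?thesis by simp
qed

lemma recursive_on_prod:
  assumes "recursive_on k b" "recursive_on (Suc k) (\<lambda>ys. f (ys ! 0) (tl ys))"
  shows "recursive_on k (\<lambda>xs. \<Prod>i<b xs. f i xs)"
proof -
  have "recursive_on k (\<lambda>xs. rec_nat 1 (\<lambda>y r. (\<lambda>zs. zs ! 1 * f (zs ! 0) (drop 2 zs)) (y # r # xs)) (b xs))"
    using recursive_on_skip[OF assms(2)]
    by (intro recursive_on_rec_nat recursive_on_mult recursive_on_nth recursive_on_const assms) auto
  moreover have "rec_nat 1 (\<lambda>y r. r * f y xs) n = (\<Prod>i<n. f i xs)" for n xs by (induction n) auto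
  ultimately show ?thesis by simp
qed

lemma recursive_on_nth_tl: "Suc i < k \<Longrightarrow> recursive_on k (\<lambda>xs. tl xs ! i)"
  by (rule recursive_on_cong[OF recursive_on_nth[of "Suc i"]]) (auto simp: nth_tl)

lemma recursive_on_nth_tl_tl: "Suc (Suc i) < k \<Longrightarrow> recursive_on k (\<lambda>xs. tl (tl xs) ! i)"
  by (rule recursive_on_cong[OF recursive_on_nth[of "Suc (Suc i)"]]) (auto simp: nth_tl)

lemmas recursive_on_intros =
  recursive_on_add recursive_on_mult recursive_on_diff recursive_on_const recursive_on_Suc
  recursive_on_nth recursive_on_nth_tl recursive_on_nth_tl_tl recursive_on_sum recursive_on_prod

lemma recursive_on_le:
  assumes "recursive_on k a" "recursive_on k b"
  shows "recursive_on k (\<lambda>xs. of_bool (a xs \<le> b xs))"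
  by (rule recursive_on_cong[where f = "\<lambda>xs. 1 - (a xs - b xs)"])
     (auto intro!: recursive_on_intros assms)

lemma recursive_on_eq:
  assumes "recursive_on k a" "recursive_on k b"
  shows "recursive_on k (\<lambda>xs. of_bool (a xs = b xs))"
  by (rule recursive_on_cong[where f = "\<lambda>xs. of_bool (a xs \<le> b xs) * of_bool (b xs \<le> a xs)"])
     (auto intro!: recursive_on_intros recursive_on_le assms)

lemma recursive_on_power:
  assumes "recursive_on k a" "recursive_on k b"
  shows "recursive_on k (\<lambda>xs. a xs ^ b xs)"
proof (rule recursive_on_binary[OF _ assms])
  have "recursive_on 2 (\<lambda>xs. \<Prod>i<xs ! 1. xs ! 0)"
    by (intro recursive_on_intros) auto
  then show "recursive_on 2 (\<lambda>xs. xs ! 0 ^ xs ! 1)" by simp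
qed

text \<open>Counts the positive multiples of \<open>k\<close> up to \<open>m\<close>, which makes
  division a bounded sum. The factor \<open>of_bool (1 \<le> k)\<close> reproduces
  \<open>m div 0 = 0\<close>.\<close>

lemma div_eq_sum: "(m :: nat) div k = (\<Sum>z<m. of_bool (Suc z * k \<le> m) * of_bool (1 \<le> k))"
proof (cases "k = 0")
  case False
  have *: "Suc z * k \<le> m \<longleftrightarrow> z < m div k" for z
    using False by (metis less_eq_div_iff_mult_less_eq gr0I Suc_le_eq)
  have "{..<m} \<inter> {z. z < m div k} = {..<m div k}"
  proof (rule equalityI; rule subsetI)
    fix z assume "z \<in> {..<m div k}"
    then have "z < m" using div_le_dividend[of m k] by (simp only: lessThan_iff)
    with \<open>z \<in> _\<close> show "z \<in> {..<m} \<inter> {z. z < m div k}" by simp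
  qed simp
  then show ?thesis
    using False unfolding * by (simp add: sum_of_bool_eq)
qed simp

lemma recursive_on_div:
  assumes "recursive_on k a" "recursive_on k b"
  shows "recursive_on k (\<lambda>xs. a xs div b xs)"
proof (rule recursive_on_binary[OF _ assms])
  have "recursive_on 2 (\<lambda>xs. \<Sum>z<xs ! 0. of_bool (Suc z * xs ! 1 \<le> xs ! 0) * of_bool (1 \<le> xs ! 1))"
    by (intro recursive_on_intros recursive_on_le) auto
  then show "recursive_on 2 (\<lambda>xs. xs ! 0 div xs ! 1)"
    by (simp only: div_eq_sum[symmetric])
qed

lemma recursive_on_bit:
  assumes "recursive_on k a" "recursive_on k b"
  shows "recursive_on k (\<lambda>xs. of_bool (b xs \<in> set_decode (a xs)))"
proof (rule recursive_on_cong)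
  \<comment> \<open>The parity of \<open>a xs div 2 ^ b xs\<close>, that is, the binary digit of
    \<open>a xs\<close> at position \<open>b xs\<close>.\<close>
  show "recursive_on k (\<lambda>xs. a xs div 2 ^ b xs - 2 * (a xs div 2 ^ b xs div 2))"
    by (intro recursive_on_intros recursive_on_div recursive_on_power assms)
qed (auto simp: set_decode_def minus_mult_div_eq_mod odd_iff_mod_2_eq_one[symmetric] mod2_eq_if)

lemma recursive_on_prod_encode:
  assumes "recursive_on k a" "recursive_on k b"
  shows "recursive_on k (\<lambda>xs. prod_encode (a xs, b xs))"
  unfolding prod_encode_def triangle_def prod.case
  by (intro recursive_on_intros recursive_on_div assms)

text \<open>The rational number \<open>p / q\<close> stands in for \<open>C_d d * (1 - \<eta>)\<close>, which need not be a computable real;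
  the \<open>Suc\<close> absorbs the rounding of the size.\<close>

definition ind_count :: "nat \<Rightarrow> nat \<Rightarrow> nat \<Rightarrow> nat" where
  "ind_count p q x = (\<Sum>n<Suc x. \<Sum>g<Suc x. of_bool (prod_encode (n, g) = x) *
     (\<Sum>s<2 ^ n. of_bool (p * n \<le> q * Suc (\<Sum>u<n. of_bool (u \<in> set_decode s))) *
       (\<Prod>u<n. \<Prod>v<n. 1 - of_bool (u \<in> set_decode s) * of_bool (v \<in> set_decode s) *
          of_bool (prod_encode (u, v) \<in> set_decode g))))"

lemma computable_ind_count: "computable (ind_count p q)"
proof -
  \<comment> \<open>Each of the five nested sums and products puts its index in front of the
    argument list, so outer variables appear as entries of iterated tails.\<close>
  have tl3: "recursive_on k (\<lambda>xs. tl (tl (tl xs)) ! i)" if "i + 3 < k" for i k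
    by (rule recursive_on_cong[OF recursive_on_nth[of "Suc (Suc (Suc i))"]]) (use that in \<open>auto simp: nth_tl\<close>)
  have tl4: "recursive_on k (\<lambda>xs. tl (tl (tl (tl xs))) ! i)" if "i + 4 < k" for i k
    by (rule recursive_on_cong[OF recursive_on_nth[of "Suc (Suc (Suc (Suc i)))"]]) (use that in \<open>auto simp: nth_tl\<close>)
  have "recursive_on 1 (\<lambda>xs. ind_count p q (xs ! 0))"
    unfolding ind_count_def
    by (intro recursive_on_intros recursive_on_eq recursive_on_le recursive_on_prod_encode
        recursive_on_bit recursive_on_power tl3 tl4; simp)
  then obtain f where "recursive 1 f" "\<And>xs. length xs = 1 \<Longrightarrow> ind_count p q (xs ! 0) = f xs"
    unfolding recursive_on_def by blast
  then show ?thesis unfolding computable_def by (metis length_Cons list.size(3) nth_Cons_0 One_nat_def)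
qed

section \<open>Correctness of the exhaustive count\<close>

lemma set_decode_subset_iff: "set_decode s \<subseteq> {..<n} \<longleftrightarrow> s < 2 ^ n"
proof
  assume "set_decode s \<subseteq> {..<n}"
  then have "set_encode (set_decode s) \<le> set_encode {..<n}"
    unfolding set_encode_def by (intro sum_mono2) auto
  also have "set_encode {..<n} < 2 ^ n"
    by (induction n) (auto simp: set_encode_def)
  finally show "s < 2 ^ n" by simp
next
  assume "s < 2 ^ n"
  show "set_decode s \<subseteq> {..<n}"
  proof
    fix i assume "i \<in> set_decode s"
    then have "s div 2 ^ i \<noteq> 0" unfolding set_decode_def by (metis even_zero mem_Collect_eq)
    then have "2 ^ i \<le> s" by (meson div_less not_less)
    then have "2 ^ i < (2 :: nat) ^ n" using \<open>s < 2 ^ n\<close> by linarith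
    then show "i \<in> {..<n}" by simp
  qed
qed

text \<open>The codes \<open>s < 2 ^ n\<close> run through exactly the subsets of the vertex set. A
  factor of the double product is \<open>0\<close> precisely when it finds an edge within the
  decoded set, so the product is the indicator of independence.\<close>

lemma ind_count_graph_code:
  assumes "simple_graph n E"
  shows "ind_count p q (graph_code n E) =
    card {S. independent_set n E S \<and> p * n \<le> q * Suc (card S)}"
proof -
  define A where "A = {prod_encode (u, v) | u v. {u, v} \<in> E}"
  define g where "g = set_encode A"
  define ok where "ok s \<longleftrightarrow> independent_set n E (set_decode s) \<and> p * n \<le> q * Suc (card (set_decode s))" for s
  define F where "F n g = (\<Sum>s<2 ^ n. of_bool (p * n \<le> q * Suc (\<Sum>u<n. of_bool (u \<in> set_decode s))) *
       (\<Prod>u<n. \<Prod>v<n. 1 - of_bool (u \<in> set_decode s) * of_bool (v \<in> set_decode s) *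
          of_bool (prod_encode (u, v) \<in> set_decode g) :: nat))" for n g
  have "A \<subseteq> prod_encode ` ({..<n} \<times> {..<n})"
    using assms unfolding A_def simple_graph_def by fastforce
  then have "finite A" by (rule finite_subset) auto
  then have dec: "set_decode g = A" unfolding g_def by simp
  have mem: "prod_encode (u, v) \<in> A \<longleftrightarrow> {u, v} \<in> E" for u v
    unfolding A_def by auto
  let ?x = "prod_encode (n, g)"
  have "ind_count p q ?x = (\<Sum>n'<Suc ?x. \<Sum>g'<Suc ?x. of_bool (n' = n) * (of_bool (g' = g) * F n' g'))"
    unfolding ind_count_def F_def prod_encode_eq by (intro sum.cong refl) auto
  also have "\<dots> = F n g"
  proof -
    \<comment> \<open>Decoding by search: both components of a pair are at most its code, so each of
      the two sums contains the one index whose indicator survives.\<close>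
    have *: "(\<Sum>i<Suc ?x. of_bool (i = m) * H i) = H m" if "m \<le> ?x" for m and H :: "nat \<Rightarrow> nat"
      using that by (subst sum_of_bool_mult_eq) (auto simp: Int_def less_Suc_eq_le cong: conj_cong)
    show ?thesis
      unfolding sum_distrib_left[symmetric] by (simp only: * le_prod_encode_1 le_prod_encode_2)
  qed
  also have "\<dots> = (\<Sum>s<2 ^ n. of_bool (ok s))"
    unfolding F_def
  proof (intro sum.cong refl)
    fix s :: nat assume "s \<in> {..<2 ^ n}"
    then have sub: "set_decode s \<subseteq> {..<n}" by (simp add: set_decode_subset_iff)
    have "(\<Sum>u<n. of_bool (u \<in> set_decode s)) = card (set_decode s)"
      using sub by (simp add: sum_of_bool_eq Int_absorb1)
    moreover have "(\<Prod>u<n. \<Prod>v<n. 1 - of_bool (u \<in> set_decode s) * of_bool (v \<in> set_decode s) *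
          of_bool (prod_encode (u, v) \<in> set_decode g) :: nat) = of_bool (independent_set n E (set_decode s))"
    proof (cases "independent_set n E (set_decode s)")
      case True
      then have "(1 :: nat) - of_bool (u \<in> set_decode s) * of_bool (v \<in> set_decode s) *
          of_bool (prod_encode (u, v) \<in> set_decode g) = 1" for u v
        by (auto simp: independent_set_def dec mem)
      then show ?thesis using True by simp
    next
      case False
      then obtain u v where uv: "u \<in> set_decode s" "v \<in> set_decode s" "{u, v} \<in> E"
        using sub unfolding independent_set_def by blast
      then have "(\<Prod>v<n. 1 - of_bool (u \<in> set_decode s) * of_bool (v \<in> set_decode s) *
          of_bool (prod_encode (u, v) \<in> set_decode g) :: nat) = 0"
        using sub by (intro prod_zero bexI[of _ v]) (auto simp: dec mem)
      then have "(\<Prod>u<n. \<Prod>v<n. 1 - of_bool (u \<in> set_decode s) * of_bool (v \<in> set_decode s) *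
          of_bool (prod_encode (u, v) \<in> set_decode g) :: nat) = 0"
        using sub uv(1) by (subst prod_zero_iff) (auto simp del: prod_zero_iff)
      then show ?thesis using False by simp
    qed
    ultimately show "of_bool (p * n \<le> q * Suc (\<Sum>u<n. of_bool (u \<in> set_decode s))) *
       (\<Prod>u<n. \<Prod>v<n. 1 - of_bool (u \<in> set_decode s) * of_bool (v \<in> set_decode s) *
          of_bool (prod_encode (u, v) \<in> set_decode g) :: nat) = of_bool (ok s)"
      by (simp only: ok_def of_bool_conj mult.commute)
  qed
  also have "\<dots> = card {s. s < 2 ^ n \<and> ok s}"
    by (simp add: sum_of_bool_eq Int_def)
  also have "\<dots> = card {S. independent_set n E S \<and> p * n \<le> q * Suc (card S)}"
  proof (rule bij_betw_same_card[of set_decode], rule bij_betwI[where g = set_encode])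
    show "set_decode \<in> {s. s < 2 ^ n \<and> ok s} \<rightarrow> {S. independent_set n E S \<and> p * n \<le> q * Suc (card S)}"
      by (auto simp: ok_def)
    have fin: "finite S" if "independent_set n E S" for S
      using that finite_subset unfolding independent_set_def by blast
    then show "set_encode \<in> {S. independent_set n E S \<and> p * n \<le> q * Suc (card S)} \<rightarrow> {s. s < 2 ^ n \<and> ok s}"
      by (auto simp: ok_def set_decode_subset_iff[symmetric] independent_set_def)
    show "set_decode (set_encode S) = S" if "S \<in> {S. independent_set n E S \<and> p * n \<le> q * Suc (card S)}" for S
      using that fin by simp
  qed auto
  finally show ?thesis unfolding graph_code_def g_def A_def .
qed

section \<open>Switchings in regular graphs\<close>

text \<open>Ordered pairs: an edge inside \<open>A\<close> appears twice in
  \<open>arcs E A A\<close>, so degree sums hold exactly.\<close>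

definition arcs :: "nat set set \<Rightarrow> nat set \<Rightarrow> nat set \<Rightarrow> (nat \<times> nat) set" where
  "arcs E A B = {(u, v). u \<in> A \<and> v \<in> B \<and> {u, v} \<in> E}"

definition switch :: "nat set set \<Rightarrow> nat \<Rightarrow> nat \<Rightarrow> nat \<Rightarrow> nat \<Rightarrow> nat set set" where
  "switch E u v x y = E - {{u, v}, {x, y}} \<union> {{u, x}, {v, y}}"

section \<open>Degree counts for arcs\<close>

lemma simple_graph_edgeD:
  assumes "simple_graph n E" "{u, v} \<in> E"
  shows "u < n" "v < n" "u \<noteq> v"
proof -
  from assms have e: "{u, v} \<subseteq> {..<n} \<and> card {u, v} = 2"
    unfolding simple_graph_def by (rule bspec)
  show "u < n" "v < n" using e by simp_all
  show "u \<noteq> v" using e by (cases "u = v") simp_all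
qed

lemma card_neighbours:
  assumes "simple_graph n E"
  shows "card {u. {v, u} \<in> E} = vdegree E v"
  unfolding vdegree_def
proof (rule bij_betw_same_card[of "\<lambda>u. {v, u}"])
  show "bij_betw (\<lambda>u. {v, u}) {u. {v, u} \<in> E} {e \<in> E. v \<in> e}"
    unfolding bij_betw_def
  proof
    show "inj_on (\<lambda>u. {v, u}) {u. {v, u} \<in> E}"
      by (auto simp: inj_on_def doubleton_eq_iff)
    show "(\<lambda>u. {v, u}) ` {u. {v, u} \<in> E} = {e \<in> E. v \<in> e}"
    proof safe
      fix e assume "e \<in> E" "v \<in> e"
      then obtain x y where "e = {x, y}" using assms unfolding simple_graph_def card_2_iff by blast
      with \<open>v \<in> e\<close> obtain u where "e = {v, u}" by (auto simp: insert_commute)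
      with \<open>e \<in> E\<close> show "e \<in> (\<lambda>u. {v, u}) ` {u. {v, u} \<in> E}" by blast
    qed
  qed
qed

lemma finite_neighbours: "simple_graph n E \<Longrightarrow> finite {u. {v, u} \<in> E}"
  by (rule finite_subset[of _ "{..<n}"]) (auto dest: simple_graph_edgeD)

lemma finite_arcs: "simple_graph n E \<Longrightarrow> finite (arcs E A B)"
  by (rule finite_subset[of _ "{..<n} \<times> {..<n}"]) (auto simp: arcs_def dest: simple_graph_edgeD)

lemma finite_regular_graphs: "finite (regular_graphs n d)"
  by (rule finite_subset[of _ "Pow (Pow {..<n})"]) (auto simp: regular_graphs_def simple_graph_def)

lemma regular_graphs_simple: "E \<in> regular_graphs n d \<Longrightarrow> simple_graph n E"
  by (simp add: regular_graphs_def)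

lemma card_neighbours_regular:
  assumes "E \<in> regular_graphs n d" "v < n"
  shows "card {u. {v, u} \<in> E} = d"
  using assms card_neighbours by (auto simp: regular_graphs_def)

lemma card_arcs_swap: "card (arcs E A B) = card (arcs E B A)"
  by (rule bij_betw_same_card[of prod.swap], rule bij_betwI[where g = prod.swap])
     (auto simp: arcs_def insert_commute)

lemma card_arcs_degree:
  assumes E: "E \<in> regular_graphs n d" and A: "A \<subseteq> {..<n}"
  shows "card (arcs E A {..<n}) = d * card A"
proof -
  have sg: "simple_graph n E" by (rule regular_graphs_simple[OF E])
  have "arcs E A {..<n} = Sigma A (\<lambda>v. {u. {v, u} \<in> E})"
    using sg by (auto simp: arcs_def dest: simple_graph_edgeD)
  moreover have "finite A" using A finite_subset by blast
  ultimately have "card (arcs E A {..<n}) = (\<Sum>v\<in>A. card {u. {v, u} \<in> E})"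
    using finite_neighbours[OF sg] by simp
  also have "\<dots> = (\<Sum>v\<in>A. d)"
    using A by (intro sum.cong refl card_neighbours_regular[OF E]) auto
  finally show ?thesis by simp
qed

lemma card_arcs_split:
  assumes E: "E \<in> regular_graphs n d" and A: "A \<subseteq> {..<n}" and S: "S \<subseteq> {..<n}"
  shows "card (arcs E A S) + card (arcs E A ({..<n} - S)) = d * card A"
proof -
  have "arcs E A {..<n} = arcs E A S \<union> arcs E A ({..<n} - S)"
    using S by (auto simp: arcs_def)
  moreover have "arcs E A S \<inter> arcs E A ({..<n} - S) = {}" by (auto simp: arcs_def)
  ultimately show ?thesis
    using card_arcs_degree[OF E A] finite_arcs[OF regular_graphs_simple[OF E]]
    by (simp add: card_Un_disjoint)
qed

text \<open>Degree sums over \<open>S\<close> and over its complement count the edges between them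
  equally often, so these cancel. The arcs outside \<open>S\<close> are thus determined in number by
  those inside, which bounds the reverse choices of a switching.\<close>

lemma card_arcs_complement:
  assumes E: "E \<in> regular_graphs n d" and S: "S \<subseteq> {..<n}"
  shows "card (arcs E ({..<n} - S) ({..<n} - S)) + 2 * d * card S = d * n + card (arcs E S S)"
proof -
  let ?T = "{..<n} - S"
  have "card (arcs E S S) + card (arcs E S ?T) = d * card S"
    by (rule card_arcs_split[OF E S S])
  moreover have "card (arcs E ?T S) + card (arcs E ?T ?T) = d * card ?T"
    by (rule card_arcs_split[OF E _ S]) auto
  moreover have "card ?T = n - card S" "card S \<le> n"
    using S by (auto simp: card_Diff_subset finite_subset dest: card_mono[rotated])
  moreover from this have "d * card ?T + d * card S = d * n"
    by (metis distrib_left le_add_diff_inverse2)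
  ultimately show ?thesis using card_arcs_swap[of E S ?T] by linarith
qed

lemma card_exchange:
  assumes "a \<in> N" "b \<notin> N" "finite N"
  shows "card (N - {a} \<union> {b}) = card N"
  using assms card_Suc_Diff1[of N a] by simp

text \<open>The assumptions \<open>ux\<close> and \<open>vy\<close> exclude loops and multiple edges
  after the exchange. Other coincidences among the four vertices cannot occur, except for
  \<open>u\<close>, \<open>x\<close> lying in \<open>S\<close> together and \<open>v\<close>,
  \<open>y\<close> outside it together.\<close>

locale switching =
  fixes n d :: nat and E :: "nat set set" and S :: "nat set" and u v x y :: nat
  assumes E: "E \<in> regular_graphs n d"
    and S: "S \<subseteq> {..<n}"
    and uv: "(u, v) \<in> arcs E S ({..<n} - S)"
    and xy: "(x, y) \<in> arcs E S ({..<n} - S)"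
    and ux: "u \<noteq> x" "{u, x} \<notin> E"
    and vy: "v \<noteq> y" "{v, y} \<notin> E"
begin

abbreviation "E' \<equiv> switch E u v x y"

lemma mems: "u \<in> S" "x \<in> S" "v \<notin> S" "y \<notin> S" "u < n" "v < n" "x < n" "y < n"
    "{u, v} \<in> E" "{x, y} \<in> E"
  using uv xy S by (auto simp: arcs_def)

lemma distinct: "u \<noteq> v" "u \<noteq> y" "x \<noteq> v" "x \<noteq> y" "v \<noteq> u" "y \<noteq> u" "v \<noteq> x" "y \<noteq> x"
  using mems by auto

lemma simple: "simple_graph n E'"
  using regular_graphs_simple[OF E] mems ux vy
  by (auto simp: simple_graph_def switch_def)

text \<open>Each of the four vertices trades one neighbour for a new one; every other neighbourhood
  is untouched.\<close>

lemma vdegree_switch: "w < n \<Longrightarrow> vdegree E' w = d"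
proof -
  assume w: "w < n"
  have fin: "finite {z. {w, z} \<in> E}" by (rule finite_neighbours[OF regular_graphs_simple[OF E]])
  have "card {z. {w, z} \<in> E'} = card {z. {w, z} \<in> E}"
  proof -
    consider "w = u" | "w = v" | "w = x" | "w = y" | "w \<notin> {u, v, x, y}" by blast
    then show ?thesis
    proof cases
      case 1
      then have "{z. {w, z} \<in> E'} = {z. {w, z} \<in> E} - {v} \<union> {x}"
        using distinct ux vy by (auto simp: switch_def doubleton_eq_iff)
      then show ?thesis using 1 mems ux fin by (simp only:) (rule card_exchange, auto)
    next
      case 2
      then have "{z. {w, z} \<in> E'} = {z. {w, z} \<in> E} - {u} \<union> {y}"
        using distinct ux vy by (auto simp: switch_def doubleton_eq_iff)
      then show ?thesis using 2 mems vy fin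
        by (simp only:) (rule card_exchange, auto simp: insert_commute)
    next
      case 3
      then have "{z. {w, z} \<in> E'} = {z. {w, z} \<in> E} - {y} \<union> {u}"
        using distinct ux vy by (auto simp: switch_def doubleton_eq_iff)
      then show ?thesis using 3 mems ux fin
        by (simp only:) (rule card_exchange, auto simp: insert_commute)
    next
      case 4
      then have "{z. {w, z} \<in> E'} = {z. {w, z} \<in> E} - {x} \<union> {v}"
        using distinct ux vy by (auto simp: switch_def doubleton_eq_iff)
      then show ?thesis using 4 mems vy fin
        by (simp only:) (rule card_exchange, auto simp: insert_commute)
    next
      case 5
      then have "{z. {w, z} \<in> E'} = {z. {w, z} \<in> E}"
        by (auto simp: switch_def doubleton_eq_iff)
      then show ?thesis by simp
    qed
  qed
  then show ?thesis
    using card_neighbours[OF simple] card_neighbours_regular[OF E w] by metis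
qed

lemma switch_regular: "E' \<in> regular_graphs n d"
  using simple vdegree_switch by (simp add: regular_graphs_def)

text \<open>The original graph is recovered from the switched one and the four vertices; this makes
  the double counting injective.\<close>

lemma switch_back: "E = E' - {{u, x}, {v, y}} \<union> {{u, v}, {x, y}}"
  using mems ux vy by (auto simp: switch_def)

lemma arcs_switch: "arcs E' S S = arcs E S S \<union> {(u, x), (x, u)}"
  using mems by (auto simp: arcs_def switch_def doubleton_eq_iff)

lemma card_arcs_switch: "card (arcs E' S S) = card (arcs E S S) + 2"
proof -
  have "(u, x) \<notin> arcs E S S" "(x, u) \<notin> arcs E S S"
    using ux by (auto simp: arcs_def insert_commute)
  then show ?thesis
    using finite_arcs[OF regular_graphs_simple[OF E]] ux
    by (simp add: arcs_switch)
qed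

lemma switch_arcs: "(u, x) \<in> arcs E' S S" "(v, y) \<in> arcs E' ({..<n} - S) ({..<n} - S)"
  using mems by (auto simp: arcs_def switch_def)

end

text \<open>An element \<open>((u, v), (x, y))\<close> replaces the edges \<open>uv\<close> and \<open>xy\<close> leaving \<open>S\<close> by
  \<open>ux\<close> inside \<open>S\<close> and \<open>vy\<close> outside \<open>S\<close>.\<close>

definition switchings :: "nat \<Rightarrow> nat set set \<Rightarrow> nat set \<Rightarrow> ((nat \<times> nat) \<times> (nat \<times> nat)) set" where
  "switchings n E S = {((u, v), (x, y)). (u, v) \<in> arcs E S ({..<n} - S) \<and>
     (x, y) \<in> arcs E S ({..<n} - S) \<and> u \<noteq> x \<and> {u, x} \<notin> E \<and> v \<noteq> y \<and> {v, y} \<notin> E}"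

lemma card_arcs_left_le:
  assumes E: "E \<in> regular_graphs n d" and A: "A \<subseteq> {..<n}"
  shows "card (arcs E A B) \<le> d * card A"
proof -
  have "arcs E A B \<subseteq> arcs E A {..<n}"
    using regular_graphs_simple[OF E] by (auto simp: arcs_def dest: simple_graph_edgeD)
  then show ?thesis
    using card_mono[OF finite_arcs[OF regular_graphs_simple[OF E]]] card_arcs_degree[OF E A] by metis
qed

text \<open>For a fixed first arc \<open>(u, v)\<close>, a second arc is unusable only if its end in
  \<open>S\<close> is \<open>u\<close> or a neighbour of \<open>u\<close>, or its other end is
  \<open>v\<close> or a neighbour of \<open>v\<close>. Each alternative involves
  \<open>1 + d\<close> vertices with at most \<open>d\<close> arcs each, hence at most
  \<open>2 * (d + d * d)\<close> bad choices.\<close>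

lemma card_switchings:
  assumes E: "E \<in> regular_graphs n d" and S: "S \<subseteq> {..<n}"
    and m: "m = card (arcs E S ({..<n} - S))"
  shows "m * (m - 2 * (d + d * d)) \<le> card (switchings n E S)"
proof -
  let ?T = "{..<n} - S"
  let ?M = "arcs E S ?T"
  note sg = regular_graphs_simple[OF E]
  define bad where "bad u v = arcs E ({u} \<union> {z. {u, z} \<in> E}) ?T \<union> arcs E S ({v} \<union> {z. {v, z} \<in> E})" for u v
  have fin: "finite (arcs E A B)" for A B by (rule finite_arcs[OF sg])
  have one: "card (arcs E ({u} \<union> {z. {u, z} \<in> E}) B) \<le> d + d * d" if "u < n" for u B
  proof -
    have "card (arcs E ({u} \<union> {z. {u, z} \<in> E}) B) \<le> d * card ({u} \<union> {z. {u, z} \<in> E})"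
      using that finite_neighbours[OF sg] sg
      by (intro card_arcs_left_le[OF E]) (auto dest: simple_graph_edgeD)
    also have "card ({u} \<union> {z. {u, z} \<in> E}) \<le> 1 + d"
      using card_Un_le[of "{u}" "{z. {u, z} \<in> E}"] card_neighbours_regular[OF E that] by simp
    finally show ?thesis by simp
  qed
  have card_bad: "card (bad u v) \<le> 2 * (d + d * d)" if "u < n" "v < n" for u v
  proof -
    have "card (bad u v) \<le> card (arcs E ({u} \<union> {z. {u, z} \<in> E}) ?T) +
        card (arcs E S ({v} \<union> {z. {v, z} \<in> E}))"
      unfolding bad_def by (rule card_Un_le)
    also have "card (arcs E S ({v} \<union> {z. {v, z} \<in> E})) = card (arcs E ({v} \<union> {z. {v, z} \<in> E}) S)"
      by (rule card_arcs_swap)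
    also have "card (arcs E ({u} \<union> {z. {u, z} \<in> E}) ?T) + card (arcs E ({v} \<union> {z. {v, z} \<in> E}) S)
        \<le> (d + d * d) + (d + d * d)"
      by (intro add_mono one that)
    finally show ?thesis by simp
  qed
  have "Sigma ?M (\<lambda>(u, v). ?M - bad u v) \<subseteq> switchings n E S"
    by (auto simp: switchings_def bad_def arcs_def)
  moreover have "finite (switchings n E S)"
    by (rule finite_subset[of _ "?M \<times> ?M"]) (auto simp: switchings_def fin)
  ultimately have "card (Sigma ?M (\<lambda>(u, v). ?M - bad u v)) \<le> card (switchings n E S)"
    by (rule card_mono[rotated])
  moreover have "card (Sigma ?M (\<lambda>(u, v). ?M - bad u v)) = (\<Sum>(u, v)\<in>?M. card (?M - bad u v))"
    using fin by (subst card_SigmaI) (auto intro!: sum.cong)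
  moreover have "(\<Sum>(u, v)\<in>?M. card (?M - bad u v)) \<ge> (\<Sum>(u, v)\<in>?M. m - 2 * (d + d * d))"
  proof (intro sum_mono, clarify)
    fix u v assume "(u, v) \<in> ?M"
    then have "u < n" "v < n" using S by (auto simp: arcs_def)
    then have "card (bad u v) \<le> 2 * (d + d * d)" by (rule card_bad)
    moreover have "card ?M - card (bad u v) \<le> card (?M - bad u v)"
      by (rule diff_card_le_card_Diff) (auto simp: bad_def fin)
    ultimately show "m - 2 * (d + d * d) \<le> card (?M - bad u v)" using m by linarith
  qed
  ultimately show ?thesis using m by simp
qed

section \<open>Double counting of switchings\<close>

definition graphs_with_arcs :: "nat \<Rightarrow> nat \<Rightarrow> nat set \<Rightarrow> nat \<Rightarrow> nat set set set" where
  "graphs_with_arcs n d S i = {E \<in> regular_graphs n d. card (arcs E S S) = i}"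

text \<open>A graph with a switching is mapped injectively to the switched graph with its new arcs
  \<open>(u, x)\<close> and \<open>(v, y)\<close>. The domain is bounded below by
  \<open>card_switchings\<close> with \<open>m = d * k - i\<close>; the codomain pairs an arc inside
  \<open>S\<close> with one outside.\<close>

lemma card_graphs_with_arcs_step:
  assumes S: "S \<subseteq> {..<n}" and k: "card S = k" "2 * k \<le> n"
  shows "card (graphs_with_arcs n d S i) * ((d * k - i) * (d * k - i - 2 * (d + d * d)))
    \<le> card (graphs_with_arcs n d S (i + 2)) * ((i + 2) * (d * n - 2 * d * k + i + 2))"
proof -
  let ?T = "{..<n} - S"
  let ?A = "graphs_with_arcs n d S"
  let ?X = "Sigma (?A i) (\<lambda>E. switchings n E S)"
  let ?Y = "Sigma (?A (i + 2)) (\<lambda>E. arcs E S S \<times> arcs E ?T ?T)"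
  let ?f = "\<lambda>(E, (u, v), (x, y)). (switch E u v x y, (u, x), (v, y))"
  have finA: "finite (?A j)" for j
    by (rule finite_subset[OF _ finite_regular_graphs[of n d]]) (auto simp: graphs_with_arcs_def)
  have sg: "simple_graph n E" if "E \<in> ?A j" for E j
    using that by (auto simp: graphs_with_arcs_def regular_graphs_simple)
  have sw: "switching n d E S u v x y" if "(E, (u, v), (x, y)) \<in> ?X" for E u v x y
    using that S by (auto simp: switching_def switchings_def graphs_with_arcs_def)
  have fin: "finite (arcs E B C)" if "E \<in> ?A j" for E B C j
    using that finite_arcs sg by blast
  have finY: "finite ?Y"
  proof (rule finite_SigmaI[OF finA])
    fix E assume "E \<in> ?A (i + 2)"
    then show "finite (arcs E S S \<times> arcs E ?T ?T)"
      by (intro finite_cartesian_product fin)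
  qed
  have "inj_on ?f ?X"
  proof (rule inj_onI)
    fix z w assume zw: "z \<in> ?X" "w \<in> ?X" "?f z = ?f w"
    obtain E u v x y where z: "z = (E, (u, v), (x, y))" by (metis surj_pair)
    obtain F u' v' x' y' where w: "w = (F, (u', v'), (x', y'))" by (metis surj_pair)
    have "u = u'" "x = x'" "v = v'" "y = y'" "switch E u v x y = switch F u' v' x' y'"
      using zw(3) z w by auto
    then show "z = w"
      using switching.switch_back[OF sw[OF zw(1)[unfolded z]]]
        switching.switch_back[OF sw[OF zw(2)[unfolded w]]] z w by metis
  qed
  moreover have "?f ` ?X \<subseteq> ?Y"
  proof
    fix z assume "z \<in> ?f ` ?X"
    then obtain E u v x y where z: "z = ?f (E, (u, v), (x, y))" "(E, (u, v), (x, y)) \<in> ?X" by auto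
    interpret switching n d E S u v x y by (rule sw[OF z(2)])
    have "card (arcs E S S) = i" using z(2) by (auto simp: graphs_with_arcs_def)
    then show "z \<in> ?Y"
      using z(1) switch_regular card_arcs_switch switch_arcs by (auto simp: graphs_with_arcs_def)
  qed
  ultimately have "card ?X \<le> card ?Y"
    using finY by (rule card_inj_on_le)
  also have "card ?Y = (\<Sum>E\<in>?A (i + 2). card (arcs E S S) * card (arcs E ?T ?T))"
    using finA finite_arcs sg by (subst card_SigmaI) (auto simp: card_cartesian_product intro: fin)
  also have "\<dots> = (\<Sum>E\<in>?A (i + 2). (i + 2) * (d * n - 2 * d * k + i + 2))"
  proof (intro sum.cong refl)
    fix E assume "E \<in> ?A (i + 2)"
    then have E: "E \<in> regular_graphs n d" "card (arcs E S S) = i + 2"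
      by (auto simp: graphs_with_arcs_def)
    \<comment> \<open>Hence the natural-number subtraction in \<open>d * n - 2 * d * k\<close> does
      not truncate.\<close>
    have "2 * d * k \<le> d * n" using k(2) by (metis mult.assoc mult.left_commute mult_le_mono2)
    then have "card (arcs E ?T ?T) = d * n - 2 * d * k + i + 2"
      using card_arcs_complement[OF E(1) S] unfolding E(2) k(1) by linarith
    then show "card (arcs E S S) * card (arcs E ?T ?T) = (i + 2) * (d * n - 2 * d * k + i + 2)"
      using E(2) by simp
  qed
  finally have "card ?X \<le> card (?A (i + 2)) * ((i + 2) * (d * n - 2 * d * k + i + 2))" by simp
  moreover have "card (?A i) * ((d * k - i) * (d * k - i - 2 * (d + d * d))) \<le> card ?X"
  proof -
    have "(\<Sum>E\<in>?A i. (d * k - i) * (d * k - i - 2 * (d + d * d))) \<le> (\<Sum>E\<in>?A i. card (switchings n E S))"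
    proof (intro sum_mono)
      fix E assume "E \<in> ?A i"
      then have E: "E \<in> regular_graphs n d" "card (arcs E S S) = i"
        by (auto simp: graphs_with_arcs_def)
      have "d * k - i = card (arcs E S ?T)"
        using card_arcs_split[OF E(1) S S] E(2) k(1) by simp
      from card_switchings[OF E(1) S this]
      show "(d * k - i) * (d * k - i - 2 * (d + d * d)) \<le> card (switchings n E S)" .
    qed
    also have "\<dots> = card ?X"
    proof (subst card_SigmaI)
      show "\<forall>E\<in>?A i. finite (switchings n E S)"
      proof
        fix E assume "E \<in> ?A i"
        show "finite (switchings n E S)"
          by (rule finite_subset[of _ "arcs E S ?T \<times> arcs E S ?T"])
             (auto simp: switchings_def finite_arcs[OF sg[OF \<open>E \<in> ?A i\<close>]])
      qed
    qed (auto simp: finA)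
    finally show ?thesis by simp
  qed
  ultimately show ?thesis by linarith
qed

text \<open>The steps for \<open>i = 2 * j\<close> telescope. The products stay undivided, since the
  counts may vanish and the subtractions may truncate.\<close>

lemma card_graphs_with_arcs_prod:
  assumes S: "S \<subseteq> {..<n}" and k: "card S = k" "2 * k \<le> n"
  shows "card (graphs_with_arcs n d S 0) * (\<Prod>j<J. (d * k - 2 * j) * (d * k - 2 * j - 2 * (d + d * d)))
    \<le> card (graphs_with_arcs n d S (2 * J)) * (\<Prod>j<J. (2 * j + 2) * (d * n - 2 * d * k + 2 * j + 2))"
proof (induction J)
  case (Suc J)
  let ?F = "\<lambda>j. (d * k - 2 * j) * (d * k - 2 * j - 2 * (d + d * d))"
  let ?B = "\<lambda>j. (2 * j + 2) * (d * n - 2 * d * k + 2 * j + 2)"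
  let ?a = "\<lambda>i. card (graphs_with_arcs n d S i)"
  have "?a 0 * (\<Prod>j<Suc J. ?F j) = (?a 0 * (\<Prod>j<J. ?F j)) * ?F J"
    by (simp only: prod.lessThan_Suc mult.assoc)
  also have "\<dots> \<le> (?a (2 * J) * (\<Prod>j<J. ?B j)) * ?F J"
    by (rule mult_le_mono1[OF Suc.IH])
  also have "\<dots> = (?a (2 * J) * ?F J) * (\<Prod>j<J. ?B j)" by (simp only: mult_ac)
  also have "\<dots> \<le> (?a (2 * J + 2) * ?B J) * (\<Prod>j<J. ?B j)"
    by (rule mult_le_mono1[OF card_graphs_with_arcs_step[OF S k]])
  also have "\<dots> = ?a (2 * J + 2) * (\<Prod>j<Suc J. ?B j)" by (simp only: prod.lessThan_Suc mult_ac)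
  also have "2 * J + 2 = 2 * Suc J" by simp
  finally show ?case .
qed simp

text \<open>Bounding the number of graphs with \<open>2 * J\<close> arcs in \<open>S\<close> by the
  number of all graphs turns the chained steps into a probability bound. The condition on
  \<open>J\<close> keeps the future denominators untruncated and positive.\<close>

lemma card_graphs_with_independent_set:
  assumes S: "S \<subseteq> {..<n}" and k: "card S = k" "2 * k \<le> n"
    and J: "\<And>j. j < J \<Longrightarrow> 2 * j + 2 * (d + d * d) < d * k"
  shows "real (card {E \<in> regular_graphs n d. independent_set n E S}) \<le>
    real (card (regular_graphs n d)) *
    (\<Prod>j<J. (2 * real j + 2) * (real d * real n - 2 * real d * real k + 2 * real j + 2) /
       ((real d * real k - 2 * real j) * (real d * real k - 2 * real j - 2 * (real d + real d * real d))))"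
proof -
  let ?F = "\<lambda>j. (d * k - 2 * j) * (d * k - 2 * j - 2 * (d + d * d))"
  let ?B = "\<lambda>j. (2 * j + 2) * (d * n - 2 * d * k + 2 * j + 2)"
  let ?R = "regular_graphs n d"
  have "graphs_with_arcs n d S 0 = {E \<in> ?R. independent_set n E S}"
  proof -
    have "card (arcs E S S) = 0 \<longleftrightarrow> independent_set n E S" if "E \<in> ?R" for E
      using S finite_arcs[OF regular_graphs_simple[OF that], of S S]
      by (auto simp: independent_set_def arcs_def)
    then show ?thesis by (auto simp: graphs_with_arcs_def)
  qed
  then have "card {E \<in> ?R. independent_set n E S} * (\<Prod>j<J. ?F j) \<le>
      card (graphs_with_arcs n d S (2 * J)) * (\<Prod>j<J. ?B j)"
    using card_graphs_with_arcs_prod[OF S k, of d J] by simp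
  also have "\<dots> \<le> card ?R * (\<Prod>j<J. ?B j)"
    by (intro mult_le_mono1 card_mono finite_regular_graphs) (auto simp: graphs_with_arcs_def)
  finally have "real (card {E \<in> ?R. independent_set n E S} * (\<Prod>j<J. ?F j)) \<le>
      real (card ?R * (\<Prod>j<J. ?B j))"
    by (simp only: of_nat_le_iff)
  then have "real (card {E \<in> ?R. independent_set n E S}) * (\<Prod>j<J. real (?F j)) \<le>
      real (card ?R) * (\<Prod>j<J. real (?B j))"
    by (simp only: of_nat_mult of_nat_prod)
  moreover have pos: "(\<Prod>j<J. real (?F j)) > 0"
  proof (intro prod_pos)
    fix j assume "j \<in> {..<J}"
    then have "0 < d * k - 2 * j" "0 < d * k - 2 * j - 2 * (d + d * d)" using J[of j] by auto
    then show "0 < real (?F j)" by (simp only: of_nat_0_less_iff nat_0_less_mult_iff simp_thms)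
  qed
  ultimately have "real (card {E \<in> ?R. independent_set n E S}) \<le>
      real (card ?R) * (\<Prod>j<J. real (?B j)) / (\<Prod>j<J. real (?F j))"
    by (simp only: pos_le_divide_eq)
  also have "\<dots> = real (card ?R) * (\<Prod>j<J. real (?B j) / real (?F j))"
    by (simp add: prod_dividef)
  also have "(\<Prod>j<J. real (?B j) / real (?F j)) =
    (\<Prod>j<J. (2 * real j + 2) * (real d * real n - 2 * real d * real k + 2 * real j + 2) /
       ((real d * real k - 2 * real j) * (real d * real k - 2 * real j - 2 * (real d + real d * real d))))"
  proof (intro prod.cong refl)
    fix j assume "j \<in> {..<J}"
    then have j: "2 * j + 2 * (d + d * d) < d * k" using J by simp
    have "2 * d * k \<le> d * n" using k(2) by (metis mult.assoc mult.left_commute mult_le_mono2)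
    then have "real (d * n - 2 * d * k) = real d * real n - 2 * real d * real k"
      by (simp add: of_nat_diff)
    moreover have "real (d * k - 2 * j) = real d * real k - 2 * real j"
      using j by (simp add: of_nat_diff)
    moreover have "real (d * k - 2 * j - 2 * (d + d * d)) = real d * real k - 2 * real j - 2 * (real d + real d * real d)"
      using j by (simp add: of_nat_diff)
    ultimately show "real (?B j) / real (?F j) = (2 * real j + 2) * (real d * real n - 2 * real d * real k + 2 * real j + 2) /
       ((real d * real k - 2 * real j) * (real d * real k - 2 * real j - 2 * (real d + real d * real d)))"
      by (simp only: of_nat_mult of_nat_add of_nat_numeral)
  qed
  finally show ?thesis .
qed

section \<open>Existence of regular graphs\<close>

lemma circulant_regular:
  assumes D: "D \<subseteq> {0<..<n}" and sym: "\<And>x. x \<in> D \<Longrightarrow> n - x \<in> D"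
  shows "{{u, v} | u v. u < v \<and> v < n \<and> v - u \<in> D} \<in> regular_graphs n (card D)"
proof -
  let ?E = "{{u, v} | u v. u < v \<and> v < n \<and> v - u \<in> D}"
  have sg: "simple_graph n ?E" unfolding simple_graph_def by (auto simp: card_2_iff)
  have "vdegree ?E v = card D" if v: "v < n" for v
  proof -
    \<comment> \<open>\<open>?f x\<close> is \<open>v - x\<close> modulo \<open>n\<close>: the graph
      is the Cayley graph of the integers modulo \<open>n\<close> with symmetric connection set
      \<open>D\<close>.\<close>
    let ?f = "\<lambda>x. if x \<le> v then v - x else v + n - x"
    have mem: "{v, u} \<in> ?E \<longleftrightarrow> (u < v \<and> v - u \<in> D) \<or> (v < u \<and> u < n \<and> u - v \<in> D)" for u
      using v by (auto simp: doubleton_eq_iff)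
    have "{u. {v, u} \<in> ?E} = ?f ` D"
    proof (intro equalityI subsetI)
      fix u assume "u \<in> {u. {v, u} \<in> ?E}"
      then consider "u < v" "v - u \<in> D" | "v < u" "u < n" "u - v \<in> D" using mem by auto
      then show "u \<in> ?f ` D"
      proof cases
        case 1
        then show ?thesis by (intro image_eqI[of _ _ "v - u"]) auto
      next
        case 2
        then show ?thesis using sym[OF 2(3)] by (intro image_eqI[of _ _ "n - (u - v)"]) auto
      qed
    next
      fix u assume "u \<in> ?f ` D"
      then obtain x where x: "x \<in> D" "u = ?f x" by blast
      have xn: "0 < x" "x < n" using x D by auto
      show "u \<in> {u. {v, u} \<in> ?E}"
      proof (cases "x \<le> v")
        case True
        then have "u < v" "v - u = x" using x xn by auto
        then show ?thesis using x mem by simp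
      next
        case False
        then have "v < u" "u < n" "u - v = n - x" using x xn v by auto
        then show ?thesis using sym[OF x(1)] mem by simp
      qed
    qed
    moreover have "inj_on ?f D"
    proof (rule inj_onI)
      fix x y assume "x \<in> D" "y \<in> D" "?f x = ?f y"
      moreover from this have "0 < x" "x < n" "0 < y" "y < n" using D by auto
      ultimately show "x = y" using v by (auto split: if_splits)
    qed
    ultimately have "card {u. {v, u} \<in> ?E} = card D" by (simp only: card_image)
    then show ?thesis using card_neighbours[OF sg] by metis
  qed
  then show ?thesis using sg by (simp add: regular_graphs_def)
qed

text \<open>A circulant graph serves: differences up to \<open>d div 2\<close> in both directions
  and, for odd \<open>d\<close>, also the antipode \<open>n / 2\<close>, which exists because
  \<open>n\<close> is then even.\<close>

lemma regular_graphs_nonempty: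
  assumes "even (d * n)" "d < n"
  shows "regular_graphs n d \<noteq> {}"
proof -
  define h where "h = d div 2"
  let ?D = "{1..h} \<union> {n - h..<n}"
  have h: "2 * h \<le> d" by (simp add: h_def)
  have disj: "{1..h} \<inter> {n - h..<n} = {}" using h assms(2) by auto
  have c0: "card ?D = 2 * h" using disj h assms(2) by (subst card_Un_disjoint) auto
  have s0: "?D \<subseteq> {0<..<n}" using h assms(2) by auto
  have sym0: "n - x \<in> ?D" if "x \<in> ?D" for x using that h assms(2) by auto
  show ?thesis
  proof (cases "even d")
    case True
    then have "card ?D = d" using c0 by (simp add: h_def)
    then show ?thesis using circulant_regular[OF s0 sym0] by auto
  next
    case False
    then have "even n" using assms(1) by simp
    then obtain m where m: "n = 2 * m" by blast
    have d: "d = 2 * h + 1" using False by (simp add: h_def)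
    let ?I = "insert m ?D"
    have "h < m" using m d assms(2) by linarith
    then have "m \<notin> {1..h}" "m \<notin> {n - h..<n}" using m by auto
    then have "m \<notin> ?D" by blast
    then have "card ?I = d" using c0 d by simp
    moreover have D: "?I \<subseteq> {0<..<n}" using s0 m assms(2) by auto
    moreover have sym: "n - x \<in> ?I" if "x \<in> ?I" for x using that sym0 m by auto
    ultimately show ?thesis using circulant_regular[OF D sym] by auto
  qed
qed

section \<open>Estimates of the switching product\<close>

text \<open>A Stirling bound: the right side is \<open>e * J * (J / e) ^ J\<close>. The induction
  step amounts to \<open>(1 - 1 / (J + 1)) ^ (J + 1) \<le> 1 / e\<close>.\<close>

lemma fact_le_power_exp:
  assumes "J \<ge> 1"
  shows "fact J \<le> real J ^ (J + 1) * exp (1 - real J)"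
  using assms
proof (induction J rule: nat_induct_at_least)
  case (Suc J)
  have J: "real J > 0" using Suc by simp
  have "real J ^ (J + 1) * exp 1 \<le> real (Suc J) ^ (J + 1)"
  proof -
    have "real J / real (Suc J) = 1 + (- 1 / real (Suc J))" by (simp add: field_simps)
    also have "\<dots> \<le> exp (- 1 / real (Suc J))" by (rule exp_ge_add_one_self)
    finally have "(real J / real (Suc J)) ^ (J + 1) \<le> exp (- 1 / real (Suc J)) ^ (J + 1)"
      by (intro power_mono) auto
    also have "\<dots> = exp (real (J + 1) * (- 1 / real (Suc J)))" by (simp only: exp_of_nat_mult)
    also have "\<dots> = exp (- 1)" by simp
    finally have "real J ^ (J + 1) \<le> exp (- 1) * real (Suc J) ^ (J + 1)"
      by (simp only: power_divide pos_divide_le_eq zero_less_power of_nat_0_less_iff zero_less_Suc)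
    then have "real J ^ (J + 1) * exp 1 \<le> exp (- 1) * real (Suc J) ^ (J + 1) * exp 1"
      by (intro mult_right_mono) auto
    also have "\<dots> = real (Suc J) ^ (J + 1)" by (simp add: exp_minus)
    finally show ?thesis .
  qed
  then have "real J ^ (J + 1) * exp 1 * exp (- real J) \<le> real (Suc J) ^ (J + 1) * exp (- real J)"
    by (intro mult_right_mono) auto
  then have step: "real J ^ (J + 1) * exp (1 - real J) \<le> real (Suc J) ^ (J + 1) * exp (- real J)"
    by (simp only: mult.assoc exp_add[symmetric]) simp
  have "fact (Suc J) = real (Suc J) * fact J" by simp
  also have "\<dots> \<le> real (Suc J) * (real J ^ (J + 1) * exp (1 - real J))"
    by (intro mult_left_mono Suc.IH) auto
  also have "\<dots> \<le> real (Suc J) * (real (Suc J) ^ (J + 1) * exp (- real J))"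
    by (intro mult_left_mono step) auto
  also have "\<dots> = real (Suc J) ^ (Suc J + 1) * exp (1 - real (Suc J))" by simp
  finally show ?case .
qed simp

text \<open>Convexity puts \<open>exp\<close> below its chord on \<open>[0, 2/3]\<close>, and
  \<open>exp (2/3) \<le> 2\<close> since \<open>ln 2 \<ge> 2/3\<close>.\<close>

lemma exp_two_thirds_le:
  assumes "0 \<le> x" "x \<le> 1"
  shows "exp (2 / 3 * x) \<le> 1 + (x :: real)"
proof -
  have "exp ((1 - x) *\<^sub>R 0 + x *\<^sub>R (2 / 3)) \<le> (1 - x) * exp 0 + x * exp (2 / 3 :: real)"
    by (rule convex_onD[OF exp_convex]) (use assms in auto)
  moreover have "exp (2 / 3 :: real) \<le> 2"
    using ln2_ge_two_thirds by (metis exp_le_cancel_iff exp_ln zero_less_numeral)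
  then have "x * exp (2 / 3) \<le> x * 2" using assms by (intro mult_left_mono)
  ultimately show ?thesis by (simp add: mult.commute)
qed

text \<open>Combines \<open>1 - r\<^sup>2 * s \<le> exp (- (r\<^sup>2 * s))\<close> with
  \<open>exp (2/3 * (r * s)) \<le> 1 + r * s\<close>. The exponent is linear in \<open>s\<close>, so
  a product over many \<open>s\<close> becomes a sum in the exponent.\<close>

lemma one_minus_le_exp_mult_square:
  fixes r s :: real
  assumes "0 \<le> r" "r \<le> 1" "0 \<le> s" "s \<le> 1"
  shows "1 - r\<^sup>2 * s \<le> exp (- (r\<^sup>2 + 4 / 3 * r) * s) * (1 + r * s)\<^sup>2"
proof -
  have rs: "0 \<le> r * s" using assms by simp
  have rs1: "r * s \<le> 1" using assms by (intro mult_le_one)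
  have "1 - r\<^sup>2 * s \<le> exp (- (r\<^sup>2 * s))" using exp_ge_add_one_self[of "- (r\<^sup>2 * s)"] by simp
  also have "\<dots> = exp (- (r\<^sup>2 + 4 / 3 * r) * s) * (exp (2 / 3 * (r * s)))\<^sup>2"
    by (simp add: exp_double[symmetric] exp_add[symmetric]) (simp add: algebra_simps)
  also have "\<dots> \<le> exp (- (r\<^sup>2 + 4 / 3 * r) * s) * (1 + r * s)\<^sup>2"
    using rs rs1 by (intro mult_left_mono power_mono exp_two_thirds_le) auto
  finally show ?thesis .
qed

text \<open>With \<open>2 * (x + 1) = \<alpha> * K * t\<close> and \<open>c = 0\<close>, the quotient is asymptotically
  \<open>t * (1 - r\<^sup>2 * (1 - t)) / (1 + r * (1 - t))\<^sup>2\<close>; the factor \<open>exp (1 / 1000)\<close> absorbs \<open>c\<close>.\<close>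

lemma switching_factor_le:
  fixes D K \<alpha> r c t T :: real
  assumes K: "K = \<alpha> * D" "D > 0" and \<alpha>: "0 < \<alpha>" "\<alpha> < 1 / 2" and r: "r = \<alpha> / (1 - \<alpha>)"
    and t: "0 \<le> t" "t \<le> 1" and T: "0 \<le> T" "2 * T \<le> \<alpha> * K" and x: "x + 1 = T * t"
    and c: "c > 0" "K \<ge> 2002 * c"
  shows "(2 * x + 2) * (D - 2 * K + 2 * x + 2) / ((K - 2 * x) * (K - 2 * x - c))
    \<le> t * exp (- (r\<^sup>2 + 4 / 3 * r) * (1 - t)) * exp (1 / 1000)"
proof -
  have r01: "0 \<le> r" "r \<le> 1" using \<alpha> unfolding r by (auto simp: field_simps)
  have Kpos: "K > 0" using K \<alpha> by simp
  \<comment> \<open>The denominator factor \<open>K - 2 * x\<close> lowered by 2, so that it is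
    governed by \<open>x + 1 = T * t\<close>.\<close>
  define y where "y = K - 2 * x - 2"
  have Tt: "2 * T * t \<le> \<alpha> * K * t" using T t by (intro mult_right_mono) auto
  have Tt0: "0 \<le> T * t" using T t by simp
  have "\<alpha> * K * t \<le> \<alpha> * K * 1" using \<alpha> Kpos t by (intro mult_left_mono) auto
  also have "\<alpha> * K * 1 \<le> 1 / 2 * K" using \<alpha> Kpos by simp
  finally have "\<alpha> * K * t \<le> K / 2" by simp
  have y: "y \<ge> K * (1 - \<alpha> * t)" using Tt x by (simp add: y_def algebra_simps)
  have y2: "y \<ge> K / 2" using y \<open>\<alpha> * K * t \<le> K / 2\<close> by (simp add: algebra_simps)
  have ra: "\<alpha> = r * (1 - \<alpha>)" using \<alpha> r by simp
  have D2K: "D - 2 * K \<ge> 0"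
  proof -
    have "2 * \<alpha> * D \<le> 1 * D" using \<alpha> K(2) by (intro mult_right_mono) auto
    then show ?thesis using K(1) by simp
  qed
  have "(2 * x + 2) * (D - 2 * K + 2 * x + 2) = (2 * T * t) * (D - 2 * K + 2 * T * t)"
  proof -
    have "2 * x + 2 = 2 * T * t" "D - 2 * K + 2 * x + 2 = D - 2 * K + 2 * T * t"
      using x by (simp_all add: algebra_simps)
    then show ?thesis by (simp only:)
  qed
  also have "\<dots> \<le> (\<alpha> * K * t) * (D - 2 * K + \<alpha> * K * t)"
    by (rule mult_mono) (use Tt Tt0 D2K in linarith)+
  also have "\<dots> = t * (\<alpha>\<^sup>2 * D\<^sup>2 * (1 - 2 * \<alpha> + \<alpha>\<^sup>2 * t))"
    unfolding K(1) by (simp add: power2_eq_square algebra_simps)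
  \<comment> \<open>Both sides are
    \<open>(1 - \<alpha>)\<^sup>2 - \<alpha>\<^sup>2 * (1 - t)\<close>; the relation
    \<open>\<alpha> = r * (1 - \<alpha>)\<close> brings out the common factor.\<close>
  also have "1 - 2 * \<alpha> + \<alpha>\<^sup>2 * t = (1 - \<alpha>)\<^sup>2 * (1 - r\<^sup>2 * (1 - t))"
  proof -
    have "(1 - \<alpha>)\<^sup>2 * (1 - r\<^sup>2 * (1 - t)) = (1 - \<alpha>)\<^sup>2 - (r * (1 - \<alpha>))\<^sup>2 * (1 - t)"
      by (simp add: power2_eq_square algebra_simps)
    also have "\<dots> = (1 - \<alpha>)\<^sup>2 - \<alpha>\<^sup>2 * (1 - t)" using ra by simp
    finally show ?thesis by (simp add: power2_eq_square algebra_simps)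
  qed
  also have "t * (\<alpha>\<^sup>2 * D\<^sup>2 * ((1 - \<alpha>)\<^sup>2 * (1 - r\<^sup>2 * (1 - t)))) \<le>
      t * (\<alpha>\<^sup>2 * D\<^sup>2 * ((1 - \<alpha>)\<^sup>2 * (exp (- (r\<^sup>2 + 4 / 3 * r) * (1 - t)) * (1 + r * (1 - t))\<^sup>2)))"
    using t r01 by (intro mult_left_mono one_minus_le_exp_mult_square) auto
  also have "\<dots> = t * exp (- (r\<^sup>2 + 4 / 3 * r) * (1 - t)) * (\<alpha> * D * ((1 - \<alpha>) + r * (1 - \<alpha>) * (1 - t)))\<^sup>2"
    by (simp add: power2_eq_square algebra_simps)
  \<comment> \<open>The squared factor is now a lower bound for \<open>y\<^sup>2\<close> and will
    cancel against the denominator.\<close>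
  also have "\<alpha> * D * ((1 - \<alpha>) + r * (1 - \<alpha>) * (1 - t)) = K * (1 - \<alpha> * t)"
    unfolding ra[symmetric] K(1) by (simp add: algebra_simps)
  also have "t * exp (- (r\<^sup>2 + 4 / 3 * r) * (1 - t)) * (K * (1 - \<alpha> * t))\<^sup>2 \<le>
      t * exp (- (r\<^sup>2 + 4 / 3 * r) * (1 - t)) * y\<^sup>2"
  proof -
    have "\<alpha> * t \<le> 1" using \<alpha> t by (intro mult_le_one) auto
    then show ?thesis using y t Kpos by (intro mult_left_mono power_mono) auto
  qed
  also have "\<dots> \<le> t * exp (- (r\<^sup>2 + 4 / 3 * r) * (1 - t)) * (exp (1 / 1000) * ((K - 2 * x) * (K - 2 * x - c)))"
  proof -
    have e: "(1001 / 1000 :: real) \<le> exp (1 / 1000)" using exp_ge_add_one_self[of "1 / 1000 :: real"] by simp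
    have yc: "y \<ge> 0" "y + 2 - c \<ge> 0" using y2 c Kpos by auto
    \<comment> \<open>Since \<open>y \<ge> K / 2 \<ge> 1001 * c\<close>, subtracting
      \<open>c\<close> costs at most the factor \<open>1001 / 1000\<close>.\<close>
    have "y \<le> 1001 / 1000 * (y + 2 - c)" using y2 c by simp
    also have "\<dots> \<le> exp (1 / 1000) * (y + 2 - c)" using e yc by (intro mult_right_mono) auto
    finally have 1: "y \<le> exp (1 / 1000) * (y + 2 - c)" .
    have "y * y \<le> (y + 2) * (exp (1 / 1000) * (y + 2 - c))"
      using 1 yc by (intro mult_mono) auto
    then have "y\<^sup>2 \<le> exp (1 / 1000) * ((K - 2 * x) * (K - 2 * x - c))"
      by (simp add: y_def power2_eq_square algebra_simps)
    then show ?thesis using t by (intro mult_left_mono) auto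
  qed
  finally have "(2 * x + 2) * (D - 2 * K + 2 * x + 2) \<le>
      t * exp (- (r\<^sup>2 + 4 / 3 * r) * (1 - t)) * exp (1 / 1000) * ((K - 2 * x) * (K - 2 * x - c))"
    by (simp only: mult.assoc)
  moreover have "K - 2 * x > 0" "K - 2 * x - c > 0" using y2 c Kpos unfolding y_def by auto
  ultimately show ?thesis by (simp add: pos_divide_le_eq)
qed

text \<open>With \<open>t = (j + 1) / J\<close> the factors \<open>t\<close> multiply to
  \<open>fact J / J ^ J\<close>, bounded by \<open>fact_le_power_exp\<close>, and the values
  \<open>1 - t\<close> add up to \<open>(J - 1) / 2\<close>. The corrections
  \<open>exp (1 / 1000)\<close> lower the coefficient \<open>1\<close> of \<open>J\<close> to
  \<open>999 / 1000\<close>.\<close>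

lemma switching_product_le:
  fixes D K \<alpha> r c :: real
  assumes K: "K = \<alpha> * D" "D > 0" and \<alpha>: "0 < \<alpha>" "\<alpha> < 1 / 2" and r: "r = \<alpha> / (1 - \<alpha>)"
    and J: "J \<ge> 1" "2 * real J \<le> \<alpha> * K" and c: "c > 0" "K \<ge> 2002 * c"
  shows "(\<Prod>j<J. (2 * real j + 2) * (D - 2 * K + 2 * real j + 2) / ((K - 2 * real j) * (K - 2 * real j - c)))
    \<le> real J * exp (3 - (999 / 1000 + 2 / 3 * r + r\<^sup>2 / 2) * real J)"
proof -
  define t where "t j = (real j + 1) / real J" for j
  define b where "b = r\<^sup>2 + 4 / 3 * r"
  have r01: "0 \<le> r" "r \<le> 1" using \<alpha> unfolding r by (auto simp: field_simps)
  have b: "b \<le> 3"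
    using r01 power_le_one[of r 2] unfolding b_def by linarith
  have "(\<Prod>j<J. (2 * real j + 2) * (D - 2 * K + 2 * real j + 2) / ((K - 2 * real j) * (K - 2 * real j - c)))
      \<le> (\<Prod>j<J. t j * exp (- b * (1 - t j)) * exp (1 / 1000))"
  proof (intro prod_mono conjI)
    fix j assume "j \<in> {..<J}"
    then have j: "real j + 1 \<le> real J" by simp
    have t: "0 \<le> t j" "t j \<le> 1" "real j + 1 = real J * t j"
      using j J(1) by (auto simp: t_def)
    show "(2 * real j + 2) * (D - 2 * K + 2 * real j + 2) / ((K - 2 * real j) * (K - 2 * real j - c))
      \<le> t j * exp (- b * (1 - t j)) * exp (1 / 1000)"
      unfolding b_def using J by (intro switching_factor_le[OF K \<alpha> r t(1,2) _ _ t(3) c]) auto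
    have "\<alpha> * K \<le> 1 / 2 * K" using \<alpha> K by (intro mult_right_mono) auto
    then have "2 * real j \<le> K / 2" using J(2) j by simp
    moreover have "D - 2 * K \<ge> 0"
    proof -
      have "2 * \<alpha> * D \<le> 1 * D" using \<alpha> K(2) by (intro mult_right_mono) auto
      then show ?thesis using K(1) by simp
    qed
    ultimately show "0 \<le> (2 * real j + 2) * (D - 2 * K + 2 * real j + 2) / ((K - 2 * real j) * (K - 2 * real j - c))"
      using c by (intro divide_nonneg_nonneg mult_nonneg_nonneg) auto
  qed
  also have "\<dots> = (\<Prod>j<J. t j) * exp (\<Sum>j<J. - b * (1 - t j)) * exp (1 / 1000) ^ J"
    by (simp add: prod.distrib exp_sum)
  also have "(\<Prod>j<J. t j) = fact J / real J ^ J"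
  proof -
    have "(\<Prod>j<m. real j + 1) = fact m" for m
      by (induction m) (auto simp: algebra_simps)
    then show ?thesis unfolding t_def by (simp add: prod_dividef)
  qed
  also have "(\<Sum>j<J. - b * (1 - t j)) = - b * (real J - 1) / 2"
  proof -
    have "(\<Sum>j<m. real j + 1) = real m * (real m + 1) / 2" for m
      by (induction m) (auto simp: field_simps)
    then have "(\<Sum>j<J. t j) = (real J + 1) / 2"
      using J(1) unfolding t_def by (simp add: sum_divide_distrib[symmetric])
    then have "(\<Sum>j<J. 1 - t j) = (real J - 1) / 2"
      by (simp add: sum_subtractf field_simps)
    then show ?thesis by (simp add: sum_distrib_left[symmetric] sum_negf)
  qed
  also have "exp (1 / 1000 :: real) ^ J = exp (real J / 1000)" by (simp add: exp_of_nat_mult[symmetric])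
  also have "fact J / real J ^ J * exp (- b * (real J - 1) / 2) * exp (real J / 1000)
      \<le> (real J * exp (1 - real J)) * exp (- b * (real J - 1) / 2) * exp (real J / 1000)"
    using fact_le_power_exp[OF J(1)] J(1) by (intro mult_right_mono) (auto simp: field_simps)
  also have "\<dots> = real J * exp ((1 - real J) + (- b * (real J - 1) / 2) + real J / 1000)"
    by (simp only: exp_add mult.assoc)
  also have "\<dots> \<le> real J * exp (3 - (999 / 1000 + 2 / 3 * r + r\<^sup>2 / 2) * real J)"
  proof -
    have "(1 - real J) + (- b * (real J - 1) / 2) + real J / 1000 =
        1 + b / 2 - (999 / 1000 + b / 2) * real J" by (simp add: field_simps)
    \<comment> \<open>The constant is absorbed by \<open>1 + b / 2 \<le> 3\<close>, as
      \<open>b \<le> 3\<close>.\<close>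
    also have "\<dots> \<le> 3 - (999 / 1000 + 2 / 3 * r + r\<^sup>2 / 2) * real J"
      using b by (simp add: b_def field_simps)
    finally show ?thesis by (intro mult_left_mono) auto
  qed
  finally show ?thesis .
qed

section \<open>Numerical bounds near the density \<open>C_d\<close>\<close>

lemma r_d_bounds:
  assumes "d \<ge> 3"
  shows "0 < r_d d" "r_d d \<le> 1" "real d * (r_d d)\<^sup>2 \<ge> 8 / 3"
proof -
  have d: "real d \<ge> 3" using assms by simp
  show "0 < r_d d" using d by (simp add: r_d_def)
  have sq: "(r_d d)\<^sup>2 = 4 * (real d - 1) / (real d)\<^sup>2"
    using d by (simp add: r_d_def power_divide power_mult_distrib)
  have "4 * (real d - 1) \<le> (real d)\<^sup>2"
    using zero_le_power2[of "real d - 2"] by (simp add: power2_eq_square algebra_simps)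
  then have "(r_d d)\<^sup>2 \<le> 1" using d unfolding sq by simp
  then show "r_d d \<le> 1" by (simp add: abs_square_le_1 abs_le_iff)
  have "real d * (r_d d)\<^sup>2 = 4 * (real d - 1) / real d"
    using d unfolding sq by (simp add: power2_eq_square)
  \<comment> \<open>\<open>4 * (1 - 1 / d)\<close> increases with \<open>d\<close> and equals
    \<open>8 / 3\<close> at \<open>d = 3\<close>.\<close>
  also have "\<dots> \<ge> 8 / 3" using d by (simp add: field_simps)
  finally show "real d * (r_d d)\<^sup>2 \<ge> 8 / 3" .
qed

lemma C_d_bounds:
  assumes "d \<ge> 3"
  shows "0 < C_d d" "C_d d \<le> 1 / 2"
  using r_d_bounds[OF assms] by (auto simp: C_d_def field_simps)

text \<open>The bound has to exceed \<open>ln 2\<close>, the exponent of the number of all vertex sets. At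
  \<open>\<alpha> = C_d d\<close> one has \<open>r = r_d d\<close>, and \<open>d * \<alpha>\<^sup>2 / 2 = 2 * (1 - 1 / d) / (1 + r)\<^sup>2\<close>.\<close>

lemma switching_exponent_ge:
  fixes \<alpha> :: real
  assumes d: "d \<ge> 3" and \<alpha>: "997 / 1000 * C_d d \<le> \<alpha>" "\<alpha> < 1 / 2" and r: "r = \<alpha> / (1 - \<alpha>)"
  shows "705 / 1000 \<le> (999 / 1000 + 2 / 3 * r + r\<^sup>2 / 2) * (real d * \<alpha>\<^sup>2 / 2)"
proof -
  define R where "R = r_d d"
  have R: "0 < R" "R \<le> 1" "real d * R\<^sup>2 \<ge> 8 / 3" using r_d_bounds[OF d] by (auto simp: R_def)
  have \<alpha>R: "997 / 1000 * R \<le> \<alpha> * (1 + R)" using \<alpha>(1) R by (simp add: C_d_def R_def field_simps)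
  have \<alpha>0: "0 < \<alpha>" using \<alpha>(1) C_d_bounds(1)[OF d] by linarith
  \<comment> \<open>The bound on \<alpha> gives
    \<open>(1 - \<alpha>) * (1 + R) \<le> 1 + 3 / 1000 * R\<close>, and 0.994 is chosen so that
    0.994 times 1.003 is below 0.997.\<close>
  have rR: "994 / 1000 * R \<le> r"
  proof -
    have "A * (1 - \<alpha>) * (1 + R) = A * (1 + R) - A * (\<alpha> * (1 + R))" for A
      by (simp add: algebra_simps)
    then have "994 / 1000 * R * (1 - \<alpha>) * (1 + R) = 994 / 1000 * R * (1 + R) - 994 / 1000 * R * (\<alpha> * (1 + R))" .
    also have "\<dots> \<le> 994 / 1000 * R * (1 + R) - 994 / 1000 * R * (997 / 1000 * R)"
      using \<alpha>R R by (intro diff_left_mono mult_left_mono) auto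
    also have "\<dots> \<le> 997 / 1000 * R"
    proof -
      have "R * R \<le> R * 1" using R by (intro mult_left_mono) auto
      then show ?thesis using R by (simp add: algebra_simps)
    qed
    also have "\<dots> \<le> \<alpha> * (1 + R)" by (rule \<alpha>R)
    finally have "994 / 1000 * R * (1 - \<alpha>) \<le> \<alpha>"
      using R by (simp add: mult_le_cancel_right)
    then show ?thesis using \<alpha>(2) unfolding r by (simp add: field_simps)
  qed
  have "(994 / 1000 * R)\<^sup>2 \<le> r\<^sup>2" using rR R by (intro power_mono) auto
  then have "988036 / 1000000 * R\<^sup>2 \<le> r\<^sup>2" by (simp add: power_mult_distrib power_divide)
  then have bracket: "999 / 1000 + 66 / 100 * R + 49 / 100 * R\<^sup>2 \<le> 999 / 1000 + 2 / 3 * r + r\<^sup>2 / 2"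
    using rR R(1) zero_le_power2[of R] by linarith
  have half: "994 / 1000 * (4 / 3) / (1 + R)\<^sup>2 \<le> real d * \<alpha>\<^sup>2 / 2"
  proof -
    have "(997 / 1000 * R)\<^sup>2 \<le> (\<alpha> * (1 + R))\<^sup>2" using \<alpha>R R by (intro power_mono) auto
    then have "994009 / 1000000 * R\<^sup>2 \<le> \<alpha>\<^sup>2 * (1 + R)\<^sup>2"
      by (simp add: power_mult_distrib power_divide)
    then have "994 / 1000 * R\<^sup>2 \<le> \<alpha>\<^sup>2 * (1 + R)\<^sup>2"
      using zero_le_power2[of R] by linarith
    then have "real d * (994 / 1000 * R\<^sup>2) \<le> real d * (\<alpha>\<^sup>2 * (1 + R)\<^sup>2)"
      by (intro mult_left_mono) auto
    then have "994 / 1000 * (8 / 3) \<le> real d * \<alpha>\<^sup>2 * (1 + R)\<^sup>2" using R(3) by simp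
    then show ?thesis using R by (simp add: field_simps)
  qed
  \<comment> \<open>The difference of the sides decreases in \<open>R\<close> on
    \<open>[0, 1]\<close>. At \<open>R = 1\<close> they are 2.82 and about 2.848, which is where
    0.705 comes from.\<close>
  have "705 / 1000 * (1 + R)\<^sup>2 \<le> (999 / 1000 + 66 / 100 * R + 49 / 100 * R\<^sup>2) * (994 / 1000 * (4 / 3))"
  proof -
    have "R\<^sup>2 \<le> 1" using R by (intro power_le_one) auto
    then show ?thesis using R by (simp add: power2_eq_square algebra_simps)
  qed
  then have "705 / 1000 \<le> (999 / 1000 + 66 / 100 * R + 49 / 100 * R\<^sup>2) * (994 / 1000 * (4 / 3) / (1 + R)\<^sup>2)"
    using R by (simp add: pos_le_divide_eq)
  also have "\<dots> \<le> (999 / 1000 + 2 / 3 * r + r\<^sup>2 / 2) * (real d * \<alpha>\<^sup>2 / 2)"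
    using bracket half R rR by (intro mult_mono) auto
  finally show ?thesis .
qed

section \<open>The first-moment argument\<close>

text \<open>A union bound over at most \<open>2 ^ n\<close> sets. The exponent
  \<open>705 / 1000\<close> exceeds \<open>25 / 36 \<ge> ln 2\<close> by more than
  \<open>1 / 100\<close>, the decay rate. In the constant \<open>6\<close>, one \<open>3\<close>
  comes from \<open>switching_product_le\<close>; the other pays for the rounding in
  \<open>J\<close>.\<close>

lemma prob_large_independent_set_le:
  fixes k n d :: nat and \<alpha> :: real
  assumes d: "d \<ge> 3" and even: "even (d * n)" "d < n" and \<alpha>: "\<alpha> = real k / real n"
    and lo: "997 / 1000 * C_d d \<le> \<alpha>" and hi: "\<alpha> < 1 / 2"
    and k: "2002 * (2 * (1 + real d)) \<le> real k" "2 \<le> \<alpha> * (real d * real k)"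
  shows "measure_pmf.prob (pmf_of_set (regular_graphs n d)) {G. \<exists>S. independent_set n G S \<and> card S = k}
    \<le> real d * real n * exp (6 - real n / 100)"
proof -
  let ?R = "regular_graphs n d"
  define D K c r where "D = real d * real n" "K = real d * real k"
    "c = 2 * (real d + real d * real d)" "r = \<alpha> / (1 - \<alpha>)"
  note defs = this
  \<comment> \<open>Half of the typical number \<open>d * \<alpha>\<^sup>2 * n\<close> of arcs in
    \<open>S\<close>, rounded down; the chain of switchings ends at \<open>2 * J\<close>.\<close>
  define J where "J = nat \<lfloor>\<alpha> * K / 2\<rfloor>"
  define P where "P = (\<Prod>j<J. (2 * real j + 2) * (D - 2 * K + 2 * real j + 2) / ((K - 2 * real j) * (K - 2 * real j - c)))"
  have n: "real n > 0" using even(2) by simp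
  have \<alpha>0: "\<alpha> > 0" using lo C_d_bounds(1)[OF d] by linarith
  have kn: "2 * k \<le> n" using hi n unfolding \<alpha> by (simp add: field_simps)
  have K: "K = \<alpha> * D" using n by (simp add: defs \<alpha>)
  have D: "D > 0" using n d by (simp add: defs)
  have c: "c > 0" "K \<ge> 2002 * c"
  proof -
    show "c > 0" using d by (simp add: defs add_pos_pos)
    have "real d * (2002 * (2 * (1 + real d))) \<le> real d * real k" using k(1) by (intro mult_left_mono) auto
    then show "K \<ge> 2002 * c" by (simp add: defs algebra_simps)
  qed
  have aK: "\<alpha> * K \<ge> 2" using k(2) by (simp add: defs)
  have J1: "J \<ge> 1" "real J \<le> \<alpha> * K / 2" "\<alpha> * K / 2 - 1 \<le> real J"
    using aK unfolding J_def by linarith+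
  have K0: "K > 0" using c by linarith
  have aK2: "\<alpha> * K \<le> K / 2"
    using mult_right_mono[of \<alpha> "1 / 2" K] hi K0 by simp
  have r: "0 < r" "r \<le> 1" using \<alpha>0 hi by (auto simp: defs field_simps)
  have Jd: "2 * j + 2 * (d + d * d) < d * k" if "j < J" for j
  proof -
    \<comment> \<open>\<open>2 * j\<close> uses up at most half of \<open>K\<close>, and
      \<open>c\<close> is far smaller than the other half.\<close>
    have "2 * real j \<le> K / 2" using that J1 aK2 by linarith
    then have "2 * real j + c < K" using c by linarith
    then have "real (2 * j + 2 * (d + d * d)) < real (d * k)" by (simp add: defs)
    then show ?thesis by (simp only: of_nat_less_iff)
  qed
  have P: "real (card {G \<in> ?R. independent_set n G S}) \<le> real (card ?R) * P"
    if "S \<subseteq> {..<n}" "card S = k" for S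
    using card_graphs_with_independent_set[OF that kn Jd] unfolding P_def defs
    by (simp only: mult.assoc)
  have P0: "0 \<le> P"
    unfolding P_def
  proof (intro prod_nonneg ballI divide_nonneg_nonneg)
    fix j assume "j \<in> {..<J}"
    then have "2 * real j \<le> K / 2" using J1 aK2 by auto
    moreover have "D - 2 * K \<ge> 0"
      using K hi D mult_right_mono[of "2 * \<alpha>" 1 D] by simp
    ultimately show "0 \<le> (2 * real j + 2) * (D - 2 * K + 2 * real j + 2)"
      "0 \<le> (K - 2 * real j) * (K - 2 * real j - c)"
      using c by (auto intro!: mult_nonneg_nonneg)
  qed
  have fin: "finite ?R" by (rule finite_regular_graphs)
  have ne: "?R \<noteq> {}" by (rule regular_graphs_nonempty[OF even])
  have cR: "real (card ?R) > 0" using fin ne by (simp add: card_gt_0_iff)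
  let ?T = "{S. S \<subseteq> {..<n} \<and> card S = k}"
  have finT: "finite ?T" by simp
  have "card ?T \<le> card (Pow {..<n})" by (rule card_mono) auto
  then have cT: "real (card ?T) \<le> 2 ^ n"
    by (metis card_Pow card_lessThan finite_lessThan numeral_power_eq_of_nat_cancel_iff of_nat_le_iff)
  have "?R \<inter> {G. \<exists>S. independent_set n G S \<and> card S = k} = (\<Union>S\<in>?T. {G \<in> ?R. independent_set n G S})"
    by (auto simp: independent_set_def)
  then have "card (?R \<inter> {G. \<exists>S. independent_set n G S \<and> card S = k})
      \<le> (\<Sum>S\<in>?T. card {G \<in> ?R. independent_set n G S})"
    using card_UN_le[OF finT, of "\<lambda>S. {G \<in> ?R. independent_set n G S}"] by (simp only:)
  then have "real (card (?R \<inter> {G. \<exists>S. independent_set n G S \<and> card S = k}))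
      \<le> (\<Sum>S\<in>?T. real (card {G \<in> ?R. independent_set n G S}))"
    by (simp only: of_nat_sum[symmetric] of_nat_le_iff)
  also have "\<dots> \<le> (\<Sum>S\<in>?T. real (card ?R) * P)"
    using P by (intro sum_mono) auto
  also have "\<dots> = real (card ?T) * (real (card ?R) * P)" by simp
  also have "\<dots> \<le> 2 ^ n * (real (card ?R) * P)"
    using cT P0 by (intro mult_right_mono) auto
  finally have "measure_pmf.prob (pmf_of_set ?R) {G. \<exists>S. independent_set n G S \<and> card S = k} \<le> 2 ^ n * P"
    using cR by (simp add: measure_pmf_of_set[OF ne fin] field_simps)
  also have "2 ^ n * P \<le> exp (25 / 36 * real n) * (real J * exp (3 - (999 / 1000 + 2 / 3 * r + r\<^sup>2 / 2) * real J))"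
  proof (intro mult_mono)
    have "(2 :: real) ^ n = exp (real n * ln 2)" by (simp add: exp_of_nat_mult)
    then show "(2 :: real) ^ n \<le> exp (25 / 36 * real n)"
      using ln2_le_25_over_36 mult_left_mono[of "ln 2" "25 / 36 :: real" "real n"] by simp
    show "P \<le> real J * exp (3 - (999 / 1000 + 2 / 3 * r + r\<^sup>2 / 2) * real J)"
      unfolding P_def using J1 by (intro switching_product_le[OF K D \<alpha>0 hi defs(4) _ _ c]) auto
  qed (use P0 in auto)
  also have "\<dots> = real J * exp (25 / 36 * real n + (3 - (999 / 1000 + 2 / 3 * r + r\<^sup>2 / 2) * real J))"
    by (simp only: exp_add mult_ac)
  also have "\<dots> \<le> D * exp (6 - real n / 100)"
  proof (intro mult_mono)
    define B where "B = 999 / 1000 + 2 / 3 * r + r\<^sup>2 / 2"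
    have B: "0 \<le> B" "B \<le> 3" using r power_le_one[of r 2] zero_le_power2[of r] unfolding B_def by linarith+
    have "705 / 1000 * real n \<le> B * (real d * \<alpha>\<^sup>2 / 2) * real n"
      using switching_exponent_ge[OF d lo hi defs(4)] unfolding B_def by (intro mult_right_mono) auto
    also have "\<dots> = B * (\<alpha> * K / 2)" unfolding K by (simp add: defs power2_eq_square)
    also have "\<dots> \<le> B * (real J + 1)" using J1 B by (intro mult_left_mono) auto
    also have "\<dots> \<le> B * real J + 3" using B by (simp add: algebra_simps)
    finally show "exp (25 / 36 * real n + (3 - (999 / 1000 + 2 / 3 * r + r\<^sup>2 / 2) * real J)) \<le> exp (6 - real n / 100)"
      unfolding B_def[symmetric] by simp
    have "\<alpha> * K \<le> 1 * K" using aK2 K0 by simp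
    moreover have "K \<le> 1 * D" unfolding K using hi D by (intro mult_right_mono) auto
    ultimately show "real J \<le> D" using J1 aK by linarith
  qed (use D in auto)
  finally show ?thesis by (simp add: defs)
qed

text \<open>With \<open>998 / 1000\<close>, rounding down still leaves a density of at least
  \<open>997 / 1000 * C_d d\<close> for large \<open>n\<close>, while
  \<open>C_d d \<le> 1 / 2\<close> keeps it strictly below one half.\<close>

lemma whp_regular_no_independent_set:
  assumes d: "d \<ge> 3" and k: "\<And>n. k n = nat \<lfloor>998 / 1000 * C_d d * real n\<rfloor>"
  shows "whp_regular d (\<lambda>n G. \<not> (\<exists>S. independent_set n G S \<and> card S = k n))"
  unfolding whp_regular_def
proof (rule tendsto_sandwich[OF _ _ _ tendsto_const])
  let ?F = "inf sequentially (principal {n. even (d * n)})"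
  define C where "C = C_d d"
  have C: "0 < C" "C \<le> 1 / 2" using C_d_bounds[OF d] by (auto simp: C_def)
  let ?p = "\<lambda>n. measure_pmf.prob (pmf_of_set (regular_graphs n d))"
  let ?B = "\<lambda>n. {G. \<exists>S. independent_set n G S \<and> card S = k n}"
  have "\<forall>\<^sub>F n in sequentially. 1 \<le> C / 1000 * real n" using C by real_asymp
  moreover have "\<forall>\<^sub>F n in sequentially. 2002 * (2 * (1 + real d)) \<le> 997 / 1000 * C * real n"
    using C by real_asymp
  moreover have "\<forall>\<^sub>F n in sequentially. 2 \<le> (997 / 1000 * C) * (real d * (997 / 1000 * C * real n))"
    using C d by real_asymp
  moreover have "\<forall>\<^sub>F n in sequentially. d < n" by (rule eventually_gt_at_top)
  ultimately have "\<forall>\<^sub>F n in sequentially. even (d * n) \<longrightarrow> ?p n (?B n) \<le> real d * real n * exp (6 - real n / 100)"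
  proof eventually_elim
    case (elim n)
    show ?case
    proof
      assume ev: "even (d * n)"
      have n: "real n > 0" using elim(4) by simp
      have Cn: "C * real n > 0" using C n by simp
      have kn: "998 / 1000 * C * real n - 1 \<le> real (k n)" "real (k n) \<le> 998 / 1000 * C * real n"
        unfolding k C_def[symmetric] using Cn by linarith+
      have lo: "997 / 1000 * C * real n \<le> real (k n)" using kn(1) elim(1) by simp
      have lo': "997 / 1000 * C \<le> real (k n) / real n" using lo n by (simp add: pos_le_divide_eq)
      have "998 / 1000 * C < 1 / 2" using C by simp
      then have "998 / 1000 * C * real n < 1 / 2 * real n" using n by (intro mult_strict_right_mono)
      then have "real (k n) < 1 / 2 * real n" using kn(2) by linarith
      then have hi: "real (k n) / real n < 1 / 2" using n by (simp add: pos_divide_less_eq)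
      have "(997 / 1000 * C) * (real d * (997 / 1000 * C * real n)) \<le> real (k n) / real n * (real d * real (k n))"
        using lo lo' C n by (intro mult_mono mult_left_mono) auto
      then have "2 \<le> real (k n) / real n * (real d * real (k n))" using elim(3) by linarith
      then show "?p n (?B n) \<le> real d * real n * exp (6 - real n / 100)"
        using elim(2) lo lo' hi unfolding C_def
        by (intro prob_large_independent_set_le[OF d ev elim(4) refl]) auto
    qed
  qed
  then have "\<forall>\<^sub>F n in ?F. ?p n (?B n) \<le> real d * real n * exp (6 - real n / 100)"
    by (simp add: eventually_inf_principal)
  then show "\<forall>\<^sub>F n in ?F. 1 - real d * real n * exp (6 - real n / 100) \<le> ?p n {G. \<not> (\<exists>S. independent_set n G S \<and> card S = k n)}"
  proof eventually_elim
    case (elim n)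
    have "?p n {G. \<not> (\<exists>S. independent_set n G S \<and> card S = k n)} = 1 - ?p n (?B n)"
      by (subst measure_pmf.prob_compl[symmetric]) (auto intro!: arg_cong[where f = "?p n"])
    then show ?case using elim by simp
  qed
  have "(\<lambda>n. 1 - real d * real n * exp (6 - real n / 100)) \<longlonglongrightarrow> 1" by real_asymp
  then show "((\<lambda>n. 1 - real d * real n * exp (6 - real n / 100)) \<longlongrightarrow> 1) ?F"
    by (rule tendsto_mono[OF inf_le1])
  show "\<forall>\<^sub>F n in ?F. ?p n {G. \<not> (\<exists>S. independent_set n G S \<and> card S = k n)} \<le> 1"
    by (auto intro: always_eventually)
qed

section \<open>Comparison of events and conclusion\<close>

lemma whp_regular_mono:
  assumes "whp_regular d P"
    and "\<forall>\<^sub>F n in sequentially. \<forall>G\<in>regular_graphs n d. P n G \<longrightarrow> Q n G"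
  shows "whp_regular d Q"
  unfolding whp_regular_def
proof (rule tendsto_sandwich[OF _ _ assms(1)[unfolded whp_regular_def] tendsto_const])
  let ?F = "inf sequentially (principal {n. even (d * n)})"
  let ?p = "\<lambda>n. measure_pmf.prob (pmf_of_set (regular_graphs n d))"
  \<comment> \<open>For \<open>d < n\<close> the set of regular graphs is nonempty, so the
    distribution is uniform on it and an implication between events is needed only there.\<close>
  from assms(2) eventually_gt_at_top[of d]
  have "\<forall>\<^sub>F n in sequentially. even (d * n) \<longrightarrow> ?p n {G. P n G} \<le> ?p n {G. Q n G}"
  proof eventually_elim
    case (elim n)
    show ?case
    proof
      assume "even (d * n)"
      then have ne: "regular_graphs n d \<noteq> {}" using regular_graphs_nonempty elim(2) by blast
      have "card (regular_graphs n d \<inter> {G. P n G}) \<le> card (regular_graphs n d \<inter> {G. Q n G})"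
        using elim(1) finite_regular_graphs by (intro card_mono) auto
      then show "?p n {G. P n G} \<le> ?p n {G. Q n G}"
        by (simp add: measure_pmf_of_set[OF ne finite_regular_graphs] divide_right_mono)
    qed
  qed
  then show "\<forall>\<^sub>F n in ?F. ?p n {G. P n G} \<le> ?p n {G. Q n G}"
    by (simp add: eventually_inf_principal)
  show "\<forall>\<^sub>F n in ?F. ?p n {G. Q n G} \<le> 1" by (auto intro: always_eventually)
qed

lemma rational_between:
  fixes a b :: real
  assumes "0 \<le> a" "a < b"
  obtains p q :: nat where "q > 0" "a < real p / real q" "real p / real q < b"
proof -
  obtain x where x: "x \<in> \<rat>" "a < x" "x < b" using Rats_dense_in_real[OF assms(2)] by blast
  then obtain m n :: nat where "n \<noteq> 0" "\<bar>x\<bar> = real m / real n" by (rule_tac Rats_abs_nat_div_natE)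
  then show ?thesis using that[of n m] x assms(1) by auto
qed

lemma independent_set_subset: "independent_set n E S \<Longrightarrow> T \<subseteq> S \<Longrightarrow> independent_set n E T"
  unfolding independent_set_def by blast

theorem theorem7p7:
  "\<exists>\<eta>\<^sub>0::real. \<eta>\<^sub>0 > 0 \<and> (\<exists>K::real. K > 0 \<and>
     (\<forall>d::nat. d \<ge> 3 \<longrightarrow> (\<forall>\<eta>::real. 0 < \<eta> \<and> \<eta> < \<eta>\<^sub>0 \<longrightarrow>
       (\<exists>N::nat \<Rightarrow> nat. computable N \<and>
         (\<forall>n. \<forall>G\<in>regular_graphs n d.
            num_independent_sets n G (nat \<lfloor>C_d d * (1 - \<eta>) * real n\<rfloor>) \<le> N (graph_code n G)) \<and>
         whp_regular d (\<lambda>n G.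
            real (N (graph_code n G))
              \<le> 2 powr (K * (\<eta> powr (3/5) * ln (1 / \<eta>)) * real n))))))"
\<comment> \<open>With \<open>\<eta>\<^sub>0 = 1 / 1000\<close>, \<open>C_d d * (1 - \<eta>)\<close>
  stays above \<open>999 / 1000 * C_d d\<close>, which leaves room for a rational above
  \<open>998 / 1000 * C_d d\<close>. Any positive \<open>K\<close> would serve, because the count
  vanishes with high probability.\<close>
proof (rule exI[of _ "1 / 1000"], intro conjI exI[of _ 1] allI impI)
  fix d :: nat and \<eta> :: real
  assume d: "3 \<le> d" and \<eta>: "0 < \<eta> \<and> \<eta> < 1 / 1000"
  define C where "C = C_d d"
  have C: "0 < C" "C \<le> 1 / 2" using C_d_bounds[OF d] by (auto simp: C_def)
  have "998 / 1000 * C < 999 / 1000 * C" "999 / 1000 * C < C * (1 - \<eta>)" using C \<eta> by auto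
  then have "0 \<le> 998 / 1000 * C" "998 / 1000 * C < C * (1 - \<eta>)" using C by simp_all
  then obtain p q :: nat where q: "q > 0" and lo: "998 / 1000 * C < real p / real q"
    and hi: "real p / real q < C * (1 - \<eta>)"
    by (rule rational_between)
  let ?N = "ind_count p q"
  have le: "num_independent_sets n G (nat \<lfloor>C_d d * (1 - \<eta>) * real n\<rfloor>) \<le> ?N (graph_code n G)"
    if G: "G \<in> regular_graphs n d" for n G
  proof -
    let ?k = "nat \<lfloor>C * (1 - \<eta>) * real n\<rfloor>"
    \<comment> \<open>The rational lies below \<open>C * (1 - \<eta>)\<close>, so sets of the
      rounded-down size \<open>?k\<close> meet the threshold with its \<open>Suc\<close> and are
      counted.\<close>
    have "real p / real q * real n \<le> C * (1 - \<eta>) * real n" using hi by (intro mult_right_mono) auto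
    also have "\<dots> \<le> real (Suc ?k)" by linarith
    finally have "real (p * n) \<le> real (q * Suc ?k)" using q by (simp add: field_simps)
    then have pk: "p * n \<le> q * Suc ?k" by (simp only: of_nat_le_iff)
    have "finite {S. independent_set n G S \<and> p * n \<le> q * Suc (card S)}"
      by (rule finite_subset[of _ "Pow {..<n}"]) (auto simp: independent_set_def)
    moreover have "{S. independent_set n G S \<and> card S = ?k} \<subseteq> {S. independent_set n G S \<and> p * n \<le> q * Suc (card S)}"
      using pk by auto
    ultimately show ?thesis
      unfolding num_independent_sets_def ind_count_graph_code[OF regular_graphs_simple[OF G]] C_def
      by (rule card_mono)
  qed
  define k where "k n = nat \<lfloor>998 / 1000 * C_d d * real n\<rfloor>" for n
  have "whp_regular d (\<lambda>n G. real (?N (graph_code n G)) \<le> 2 powr (1 * (\<eta> powr (3/5) * ln (1 / \<eta>)) * real n))"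
  proof (rule whp_regular_mono[OF whp_regular_no_independent_set[OF d k_def]])
    \<comment> \<open>For large \<open>n\<close> the gap between the two densities outweighs the
      \<open>Suc\<close> in the threshold, so every counted set has at least \<open>k n\<close>
      elements.\<close>
    have "\<forall>\<^sub>F n in sequentially. 1 \<le> (real p / real q - 998 / 1000 * C) * real n"
      using lo by real_asymp
    then show "\<forall>\<^sub>F n in sequentially. \<forall>G\<in>regular_graphs n d. \<not> (\<exists>S. independent_set n G S \<and> card S = k n) \<longrightarrow>
        real (?N (graph_code n G)) \<le> 2 powr (1 * (\<eta> powr (3/5) * ln (1 / \<eta>)) * real n)"
    proof eventually_elim
      case (elim n)
      show ?case
      proof (intro ballI impI)
        fix G assume G: "G \<in> regular_graphs n d" and none: "\<not> (\<exists>S. independent_set n G S \<and> card S = k n)"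
        have "\<not> p * n \<le> q * Suc (card S)" if S: "independent_set n G S" for S
        proof
          assume "p * n \<le> q * Suc (card S)"
          then have "real (p * n) \<le> real (q * Suc (card S))" by (simp only: of_nat_le_iff)
          then have "real p / real q * real n \<le> real (card S) + 1" using q by (simp add: field_simps)
          then have "998 / 1000 * C * real n \<le> real (card S)" using elim by (simp add: algebra_simps)
          then have "k n \<le> card S" unfolding k_def C_def[symmetric] by linarith
          \<comment> \<open>Independence passes to subsets, so excluding the one size
            \<open>k n\<close> excludes all larger sizes.\<close>
          then obtain T where "T \<subseteq> S" "card T = k n" by (meson obtain_subset_with_card_n)
          then show False using none independent_set_subset[OF S] by blast
        qed
        then have "?N (graph_code n G) = 0"
          unfolding ind_count_graph_code[OF regular_graphs_simple[OF G]] by (auto intro: card_eq_0_iff[THEN iffD2])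
        then show "real (?N (graph_code n G)) \<le> 2 powr (1 * (\<eta> powr (3/5) * ln (1 / \<eta>)) * real n)" by simp
      qed
    qed
  qed
  then show "\<exists>N. computable N \<and>
         (\<forall>n. \<forall>G\<in>regular_graphs n d.
            num_independent_sets n G (nat \<lfloor>C_d d * (1 - \<eta>) * real n\<rfloor>) \<le> N (graph_code n G)) \<and>
         whp_regular d (\<lambda>n G.
            real (N (graph_code n G))
              \<le> 2 powr (1 * (\<eta> powr (3/5) * ln (1 / \<eta>)) * real n))"
    using computable_ind_count le by blast
qed auto

end
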